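(* $\mathsf{RCA}_0+\mathsf{B}\Sigma^0_2 \vdash \mathsf{SFS}(2) \rightarrow \mathsf{WSRRT}^2_2$.
   Context: $\mathsf{RCA}_0$ is the usual base system of reverse mathematics, and $\mathsf{B}\Sigma^0_2$ is the bounding (collection) scheme for $\Sigma^0_2$ formulas. Colorings $f:[\mathbb{N}]^2\to\mathbb{N}$ are defined on pairs $x<s$. A set $A$ is free for $f:[\mathbb{N}]^2\to\mathbb{N}$ if for all $x_1<x_2$ in $A$, if $f(x_1,x_2)\in A$ then $f(x_1,x_2)\in\{x_1,x_2\}$. The function $f$ is stable if $\lim_s f(x,s)$ exists for every $x$. $\mathsf{SFS}(2)$ is the statement "every stable function $f:[\mathbb{N}]^2\to\mathbb{N}$ has an infinite set free for $f$". $f:[\mathbb{N}]^2\to\mathbb{N}$ is 2-bounded if $|f^{-1}(y)|\le2$ for every $y$. It is weakly rainbow-stable if for all $x,y$, either $f(x,s)=f(y,s)$ for all but finitely many $s$, or $f(x,s)\neq f(y,s)$ for all but finitely many $s$. A set $R$ is a rainbow for $f$ if $f$ is injective on $[R]^2$. $\mathsf{WSRRT}^2_2$ is the statement "every weakly rainbow-stable 2-bounded coloring $f:[\mathbb{N}]^2\to\mathbb{N}$ has an infinite rainbow". *)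

theory Defs
  imports Main
begin

section \<open>The language of second-order arithmetic\<close>

text \<open>Two-sorted first-order logic with a number sort and a set sort.  Bound variables are
  de Bruijn indices, with one index space per sort: a quantifier over numbers does not affect
  set indices, and conversely.  The only set terms are variables, so they are represented by
  their index.\<close>

datatype tm =
    Var nat
  | Zero (\<open>\<^bold>0\<close>)
  | One (\<open>\<^bold>1\<close>)
  | Add tm tm (infixl \<open>\<^bold>+\<close> 65)
  | Mul tm tm (infixl \<open>\<^bold>\<times>\<close> 70)

datatype fm =
    Eq tm tm (infix \<open>\<^bold>=\<close> 50)
  | Less tm tm (infix \<open>\<^bold><\<close> 50)
  | Mem tm nat (infix \<open>\<^bold>\<in>\<close> 50)
  | Bot (\<open>\<^bold>\<bottom>\<close>)
  | Imp fm fm (infixr \<open>\<^bold>\<longrightarrow>\<close> 25)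
  | AllN fm
  | AllS fm

definition Neg :: "fm \<Rightarrow> fm" (\<open>\<^bold>\<not> _\<close> [40] 40) where
  "(\<^bold>\<not> p) = (p \<^bold>\<longrightarrow> \<^bold>\<bottom>)"
definition Or :: "fm \<Rightarrow> fm \<Rightarrow> fm" (infixr \<open>\<^bold>\<or>\<close> 30) where
  "(p \<^bold>\<or> q) = (\<^bold>\<not> p \<^bold>\<longrightarrow> q)"
definition And :: "fm \<Rightarrow> fm \<Rightarrow> fm" (infixr \<open>\<^bold>\<and>\<close> 35) where
  "(p \<^bold>\<and> q) = (\<^bold>\<not> (p \<^bold>\<longrightarrow> \<^bold>\<not> q))"
definition Iff :: "fm \<Rightarrow> fm \<Rightarrow> fm" (infixr \<open>\<^bold>\<longleftrightarrow>\<close> 25) where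
  "(p \<^bold>\<longleftrightarrow> q) = ((p \<^bold>\<longrightarrow> q) \<^bold>\<and> (q \<^bold>\<longrightarrow> p))"
definition ExN :: "fm \<Rightarrow> fm" where
  "ExN p = (\<^bold>\<not> AllN (\<^bold>\<not> p))"
definition ExS :: "fm \<Rightarrow> fm" where
  "ExS p = (\<^bold>\<not> AllS (\<^bold>\<not> p))"

subsection \<open>Substitution\<close>

primrec subT :: "(nat \<Rightarrow> tm) \<Rightarrow> tm \<Rightarrow> tm" where
  "subT \<sigma> (Var n) = \<sigma> n"
| "subT \<sigma> \<^bold>0 = \<^bold>0"
| "subT \<sigma> \<^bold>1 = \<^bold>1"
| "subT \<sigma> (s \<^bold>+ t) = subT \<sigma> s \<^bold>+ subT \<sigma> t"
| "subT \<sigma> (s \<^bold>\<times> t) = subT \<sigma> s \<^bold>\<times> subT \<sigma> t"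

definition shiftT :: "tm \<Rightarrow> tm" where
  "shiftT = subT (\<lambda>n. Var (Suc n))"

definition upN :: "(nat \<Rightarrow> tm) \<Rightarrow> nat \<Rightarrow> tm" where
  "upN \<sigma> = case_nat (Var 0) (\<lambda>n. shiftT (\<sigma> n))"

definition upS :: "(nat \<Rightarrow> nat) \<Rightarrow> nat \<Rightarrow> nat" where
  "upS \<rho> = case_nat 0 (\<lambda>n. Suc (\<rho> n))"

text \<open>Simultaneous capture-avoiding substitution of terms for number variables and of set
  variables for set variables.\<close>

primrec sub :: "(nat \<Rightarrow> tm) \<Rightarrow> (nat \<Rightarrow> nat) \<Rightarrow> fm \<Rightarrow> fm" where
  "sub \<sigma> \<rho> (s \<^bold>= t) = (subT \<sigma> s \<^bold>= subT \<sigma> t)"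
| "sub \<sigma> \<rho> (s \<^bold>< t) = (subT \<sigma> s \<^bold>< subT \<sigma> t)"
| "sub \<sigma> \<rho> (t \<^bold>\<in> X) = (subT \<sigma> t \<^bold>\<in> \<rho> X)"
| "sub \<sigma> \<rho> \<^bold>\<bottom> = \<^bold>\<bottom>"
| "sub \<sigma> \<rho> (p \<^bold>\<longrightarrow> q) = (sub \<sigma> \<rho> p \<^bold>\<longrightarrow> sub \<sigma> \<rho> q)"
| "sub \<sigma> \<rho> (AllN p) = AllN (sub (upN \<sigma>) \<rho> p)"
| "sub \<sigma> \<rho> (AllS p) = AllS (sub \<sigma> (upS \<rho>) p)"

definition shiftN :: "fm \<Rightarrow> fm" where
  "shiftN = sub (\<lambda>n. Var (Suc n)) id"
definition shiftS :: "fm \<Rightarrow> fm" where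
  "shiftS = sub Var Suc"
definition instN :: "tm \<Rightarrow> fm \<Rightarrow> fm" where
  "instN t = sub (case_nat t Var) id"
definition instS :: "nat \<Rightarrow> fm \<Rightarrow> fm" where
  "instS X = sub Var (case_nat X id)"

subsection \<open>Provability\<close>

text \<open>Classical two-sorted natural deduction with equality on the number sort.  The eigenvariable
  condition of the introduction rules for quantifiers is expressed by shifting the context.\<close>

inductive prv :: "fm set \<Rightarrow> fm \<Rightarrow> bool" (infix \<open>\<turnstile>\<close> 20) where
  Assm: "p \<in> \<Gamma> \<Longrightarrow> \<Gamma> \<turnstile> p"
| ImpI: "insert p \<Gamma> \<turnstile> q \<Longrightarrow> \<Gamma> \<turnstile> p \<^bold>\<longrightarrow> q"
| ImpE: "\<Gamma> \<turnstile> p \<^bold>\<longrightarrow> q \<Longrightarrow> \<Gamma> \<turnstile> p \<Longrightarrow> \<Gamma> \<turnstile> q"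
| RAA: "insert (\<^bold>\<not> p) \<Gamma> \<turnstile> \<^bold>\<bottom> \<Longrightarrow> \<Gamma> \<turnstile> p"
| AllNI: "shiftN ` \<Gamma> \<turnstile> p \<Longrightarrow> \<Gamma> \<turnstile> AllN p"
| AllNE: "\<Gamma> \<turnstile> AllN p \<Longrightarrow> \<Gamma> \<turnstile> instN t p"
| AllSI: "shiftS ` \<Gamma> \<turnstile> p \<Longrightarrow> \<Gamma> \<turnstile> AllS p"
| AllSE: "\<Gamma> \<turnstile> AllS p \<Longrightarrow> \<Gamma> \<turnstile> instS X p"
| EqRefl: "\<Gamma> \<turnstile> t \<^bold>= t"
| EqSubst: "\<Gamma> \<turnstile> s \<^bold>= t \<Longrightarrow> \<Gamma> \<turnstile> instN s p \<Longrightarrow> \<Gamma> \<turnstile> instN t p"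

subsection \<open>Universal closures\<close>

primrec boundT :: "nat \<Rightarrow> tm \<Rightarrow> bool" where
  "boundT k (Var n) = (n < k)"
| "boundT k \<^bold>0 = True"
| "boundT k \<^bold>1 = True"
| "boundT k (s \<^bold>+ t) = (boundT k s \<and> boundT k t)"
| "boundT k (s \<^bold>\<times> t) = (boundT k s \<and> boundT k t)"

text \<open>\<open>bound k l p\<close>: the free number variables of \<open>p\<close> are below \<open>k\<close>, its free set
  variables below \<open>l\<close>.\<close>

primrec bound :: "nat \<Rightarrow> nat \<Rightarrow> fm \<Rightarrow> bool" where
  "bound k l (s \<^bold>= t) = (boundT k s \<and> boundT k t)"
| "bound k l (s \<^bold>< t) = (boundT k s \<and> boundT k t)"
| "bound k l (t \<^bold>\<in> X) = (boundT k t \<and> X < l)"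
| "bound k l \<^bold>\<bottom> = True"
| "bound k l (p \<^bold>\<longrightarrow> q) = (bound k l p \<and> bound k l q)"
| "bound k l (AllN p) = bound (Suc k) l p"
| "bound k l (AllS p) = bound k (Suc l) p"

text \<open>The universal closures of the formulas in \<open>F\<close>, possibly with vacuous quantifiers.\<close>

definition closures :: "fm set \<Rightarrow> fm set" where
  "closures F = {(AllS ^^ l) ((AllN ^^ k) p) | k l p. p \<in> F \<and> bound k l p}"

section \<open>The theories\<close>

subsection \<open>The arithmetical hierarchy\<close>

text \<open>The bound \<open>t\<close> of a bounded quantifier does not contain the quantified variable.\<close>

definition AllB :: "tm \<Rightarrow> fm \<Rightarrow> fm" where
  "AllB t p = AllN (Var 0 \<^bold>< shiftT t \<^bold>\<longrightarrow> p)"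
definition ExB :: "tm \<Rightarrow> fm \<Rightarrow> fm" where
  "ExB t p = ExN (Var 0 \<^bold>< shiftT t \<^bold>\<and> p)"

inductive_set Delta00 :: "fm set" where
  "(s \<^bold>= t) \<in> Delta00"
| "(s \<^bold>< t) \<in> Delta00"
| "(t \<^bold>\<in> X) \<in> Delta00"
| "\<^bold>\<bottom> \<in> Delta00"
| "p \<in> Delta00 \<Longrightarrow> q \<in> Delta00 \<Longrightarrow> (p \<^bold>\<longrightarrow> q) \<in> Delta00"
| "p \<in> Delta00 \<Longrightarrow> AllB t p \<in> Delta00"
| "p \<in> Delta00 \<Longrightarrow> ExB t p \<in> Delta00"

definition Sigma01 :: "fm set" where
  "Sigma01 = {ExN p | p. p \<in> Delta00}"
definition Pi01 :: "fm set" where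
  "Pi01 = {AllN p | p. p \<in> Delta00}"
definition Sigma02 :: "fm set" where
  "Sigma02 = {ExN (AllN p) | p. p \<in> Delta00}"

subsection \<open>The axioms\<close>

definition basic_axioms :: "fm set" where
  "basic_axioms = (let m = Var 0; n = Var 1 in
    { \<^bold>\<not> (n \<^bold>+ \<^bold>1 \<^bold>= \<^bold>0),
      (m \<^bold>+ \<^bold>1 \<^bold>= n \<^bold>+ \<^bold>1 \<^bold>\<longrightarrow> m \<^bold>= n),
      (m \<^bold>+ \<^bold>0 \<^bold>= m),
      (m \<^bold>+ (n \<^bold>+ \<^bold>1) \<^bold>= (m \<^bold>+ n) \<^bold>+ \<^bold>1),
      (m \<^bold>\<times> \<^bold>0 \<^bold>= \<^bold>0),
      (m \<^bold>\<times> (n \<^bold>+ \<^bold>1) \<^bold>= (m \<^bold>\<times> n) \<^bold>+ m),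
      \<^bold>\<not> (m \<^bold>< \<^bold>0),
      (m \<^bold>< n \<^bold>+ \<^bold>1 \<^bold>\<longleftrightarrow> (m \<^bold>< n \<^bold>\<or> m \<^bold>= n)) })"

text \<open>In \<open>ind p\<close> the induction variable is \<open>Var 0\<close>; the induction step needs
  \<open>p(n + 1)\<close> in a context in which \<open>n\<close> is \<open>Var 0\<close> again.\<close>

definition ind :: "fm \<Rightarrow> fm" where
  "ind p = (instN \<^bold>0 p \<^bold>\<and>
     AllN (p \<^bold>\<longrightarrow> sub (case_nat (Var 0 \<^bold>+ \<^bold>1) (\<lambda>i. Var (Suc i))) id p)
     \<^bold>\<longrightarrow> AllN p)"

definition comprehension :: "fm \<Rightarrow> fm \<Rightarrow> fm" where
  "comprehension p q = (AllN (p \<^bold>\<longleftrightarrow> q) \<^bold>\<longrightarrow> ExS (AllN (Var 0 \<^bold>\<in> 0 \<^bold>\<longleftrightarrow> shiftS p)))"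

text \<open>\<open>(\<forall>x < a. \<exists>y. p) \<longrightarrow> (\<exists>b. \<forall>x < a. \<exists>y < b. p)\<close>, where in \<open>p\<close> the
  variables \<open>y, x, a\<close> and the further parameters are \<open>Var 0\<close>, \<open>Var 1\<close>, \<open>Var 2\<close>, \<dots>.
  On the right the binder for \<open>b\<close> comes between \<open>x\<close> and \<open>a\<close>.\<close>

definition bounding :: "fm \<Rightarrow> fm" where
  "bounding p = (AllB (Var 0) (ExN p) \<^bold>\<longrightarrow>
     ExN (AllB (Var 1) (ExB (Var 1)
       (sub (case_nat (Var 0) (case_nat (Var 1) (\<lambda>i. Var (i + 3)))) id p))))"

definition RCA0 :: "fm set" where
  "RCA0 = closures (basic_axioms \<union> {ind p | p. p \<in> Sigma01}
     \<union> {comprehension p q | p q. p \<in> Sigma01 \<and> q \<in> Pi01})"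

definition BSigma02 :: "fm set" where
  "BSigma02 = closures {bounding p | p. p \<in> Sigma02}"

section \<open>Colorings of pairs\<close>

text \<open>A function on pairs \<open>x < s\<close> is coded by the set of all \<open>((x, s), f(x, s))\<close>, with the
  usual pairing map \<open>(i, j) = (i + j)\<^sup>2 + i\<close>.  In the following definitions
  \<open>F\<close>, \<open>A\<close>, \<open>R\<close> are indices of set variables; \<open>val F x s y\<close> says \<open>f(x, s) = y\<close>.\<close>

definition pair :: "tm \<Rightarrow> tm \<Rightarrow> tm" where
  "pair s t = (s \<^bold>+ t) \<^bold>\<times> (s \<^bold>+ t) \<^bold>+ s"

definition val :: "nat \<Rightarrow> tm \<Rightarrow> tm \<Rightarrow> tm \<Rightarrow> fm" where
  "val F x s y = (pair (pair x s) y \<^bold>\<in> F)"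

definition coloring :: "nat \<Rightarrow> fm" where
  "coloring F =
    ((let n = Var 3; x = Var 2; s = Var 1; y = Var 0 in
        AllN (ExN (ExN (ExN (n \<^bold>\<in> F \<^bold>\<longrightarrow> x \<^bold>< s \<^bold>\<and> n \<^bold>= pair (pair x s) y)))))
     \<^bold>\<and> (let x = Var 2; s = Var 1; y = Var 0 in
        AllN (AllN (ExN (x \<^bold>< s \<^bold>\<longrightarrow> val F x s y))))
     \<^bold>\<and> (let x = Var 3; s = Var 2; y = Var 1; z = Var 0 in
        AllN (AllN (AllN (AllN (val F x s y \<^bold>\<and> val F x s z \<^bold>\<longrightarrow> y \<^bold>= z))))))"

definition infinite_set :: "nat \<Rightarrow> fm" where
  "infinite_set A = (let m = Var 1; n = Var 0 in AllN (ExN (m \<^bold>< n \<^bold>\<and> n \<^bold>\<in> A)))"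

subsection \<open>The stable free set theorem for pairs\<close>

definition stable :: "nat \<Rightarrow> fm" where
  "stable F = (let x = Var 3; y = Var 2; m = Var 1; s = Var 0 in
     AllN (ExN (ExN (AllN (m \<^bold>< s \<^bold>\<and> x \<^bold>< s \<^bold>\<longrightarrow> val F x s y)))))"

definition free_set :: "nat \<Rightarrow> nat \<Rightarrow> fm" where
  "free_set A F = (let x\<^sub>1 = Var 2; x\<^sub>2 = Var 1; y = Var 0 in
     AllN (AllN (AllN
       (x\<^sub>1 \<^bold>\<in> A \<^bold>\<and> x\<^sub>2 \<^bold>\<in> A \<^bold>\<and> x\<^sub>1 \<^bold>< x\<^sub>2 \<^bold>\<and> val F x\<^sub>1 x\<^sub>2 y \<^bold>\<and> y \<^bold>\<in> A
        \<^bold>\<longrightarrow> y \<^bold>= x\<^sub>1 \<^bold>\<or> y \<^bold>= x\<^sub>2))))"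

definition SFS2 :: fm where
  "SFS2 = AllS (coloring 0 \<^bold>\<and> stable 0 \<^bold>\<longrightarrow> ExS (infinite_set 0 \<^bold>\<and> free_set 0 1))"

subsection \<open>The weakly stable rainbow Ramsey theorem for pairs\<close>

text \<open>No three distinct pairs have the same color.\<close>

definition two_bounded :: "nat \<Rightarrow> fm" where
  "two_bounded F =
    (let y = Var 6; x\<^sub>1 = Var 5; s\<^sub>1 = Var 4; x\<^sub>2 = Var 3; s\<^sub>2 = Var 2; x\<^sub>3 = Var 1; s\<^sub>3 = Var 0 in
     AllN (AllN (AllN (AllN (AllN (AllN (AllN
       (x\<^sub>1 \<^bold>< s\<^sub>1 \<^bold>\<and> x\<^sub>2 \<^bold>< s\<^sub>2 \<^bold>\<and> x\<^sub>3 \<^bold>< s\<^sub>3 \<^bold>\<and> val F x\<^sub>1 s\<^sub>1 y \<^bold>\<and> val F x\<^sub>2 s\<^sub>2 y \<^bold>\<and> val F x\<^sub>3 s\<^sub>3 y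
        \<^bold>\<longrightarrow> (x\<^sub>1 \<^bold>= x\<^sub>2 \<^bold>\<and> s\<^sub>1 \<^bold>= s\<^sub>2) \<^bold>\<or> (x\<^sub>1 \<^bold>= x\<^sub>3 \<^bold>\<and> s\<^sub>1 \<^bold>= s\<^sub>3) \<^bold>\<or> (x\<^sub>2 \<^bold>= x\<^sub>3 \<^bold>\<and> s\<^sub>2 \<^bold>= s\<^sub>3)))))))))"

text \<open>\<open>f(x, s) = f(y, s)\<close>\<close>

definition agree :: "nat \<Rightarrow> tm \<Rightarrow> tm \<Rightarrow> tm \<Rightarrow> fm" where
  "agree F x y s =
    ExN (val F (shiftT x) (shiftT s) (Var 0) \<^bold>\<and> val F (shiftT y) (shiftT s) (Var 0))"

definition weakly_rainbow_stable :: "nat \<Rightarrow> fm" where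
  "weakly_rainbow_stable F = (let x = Var 3; y = Var 2; m = Var 1; s = Var 0 in
     AllN (AllN
       (ExN (AllN (m \<^bold>< s \<^bold>\<and> x \<^bold>< s \<^bold>\<and> y \<^bold>< s \<^bold>\<longrightarrow> agree F x y s)) \<^bold>\<or>
        ExN (AllN (m \<^bold>< s \<^bold>\<and> x \<^bold>< s \<^bold>\<and> y \<^bold>< s \<^bold>\<longrightarrow> \<^bold>\<not> agree F x y s)))))"

definition rainbow :: "nat \<Rightarrow> nat \<Rightarrow> fm" where
  "rainbow R F =
    (let x\<^sub>1 = Var 4; s\<^sub>1 = Var 3; x\<^sub>2 = Var 2; s\<^sub>2 = Var 1; y = Var 0 in
     AllN (AllN (AllN (AllN (AllN
       (x\<^sub>1 \<^bold>\<in> R \<^bold>\<and> s\<^sub>1 \<^bold>\<in> R \<^bold>\<and> x\<^sub>1 \<^bold>< s\<^sub>1 \<^bold>\<and> x\<^sub>2 \<^bold>\<in> R \<^bold>\<and> s\<^sub>2 \<^bold>\<in> R \<^bold>\<and> x\<^sub>2 \<^bold>< s\<^sub>2 \<^bold>\<and>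
        val F x\<^sub>1 s\<^sub>1 y \<^bold>\<and> val F x\<^sub>2 s\<^sub>2 y
        \<^bold>\<longrightarrow> x\<^sub>1 \<^bold>= x\<^sub>2 \<^bold>\<and> s\<^sub>1 \<^bold>= s\<^sub>2))))))"

definition WSRRT22 :: fm where
  "WSRRT22 = AllS (coloring 0 \<^bold>\<and> two_bounded 0 \<^bold>\<and> weakly_rainbow_stable 0
     \<^bold>\<longrightarrow> ExS (infinite_set 0 \<^bold>\<and> rainbow 0 1))"

end

theory Submission
  imports Defs "HOL-Library.Countable" "HOL-Library.Countable_Set"
begin

text \<open>By the completeness theorem it suffices to show that a countable model of
  \<open>RCA\<^sub>0 + B\<Sigma>\<^sub>2\<close> and \<open>SFS(2)\<close> satisfies \<open>WSRRT\<close>.  Let \<open>f\<close> be 2-bounded and weakly rainbow-stable in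
  such a model.  Let \<open>g(x, s)\<close> be the unique \<open>y < x\<close> with \<open>f(y, s) = f(x, s)\<close>, or \<open>x\<close> if there is
  none.  For each \<open>y < x\<close> the truth value of \<open>f(y, s) = f(x, s)\<close> is eventually constant in \<open>s\<close>,
  and \<open>B\<Sigma>\<^sub>2\<close> makes this uniform in \<open>y\<close>, so \<open>g\<close> is stable.  An infinite set \<open>A\<close> free for \<open>g\<close> contains
  no two pairs \<open>(x, s), (y, s)\<close> of the same color.  Choosing elements of \<open>A\<close> greedily so as to avoid
  the colors used before yields an infinite rainbow: by 2-boundedness and \<open>B\<Sigma>\<^sub>2\<close> finitely many
  colors do not reappear beyond some bound.  The greedy choice is a recursion on finite sets,
  which are coded by numbers inside the model.\<close>

section \<open>Substitution\<close>

text \<open>Completeness is used so that no long derivation has to be written in the calculus: the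
  argument becomes ordinary mathematics inside one fixed structure. Countability of that structure
  matters because it lets one assignment name all parameters, so that definability turns into a
  predicate on HOL functions that introduction rules can check. The model may be nonstandard, so HOL
  recursion and HOL finite sets say nothing about its numbers; each induction, comprehension or
  recursion must be an axiom instance of the exact syntactic form. Those forms allow a single
  unbounded quantifier of each kind, hence the recurring device of packing several witnesses, or
  several universally quantified stages, below one common bound. A second obstacle is that colors
  are not bounded in terms of the pairs they color: having the same color is Delta-1 but not visibly
  bounded. It is therefore first made into a set \<open>C\<close>, after which it is an atomic
  formula and may occur inside induction, bounding and recursion.\<close>

lemma subT_subT: "subT \<sigma> (subT \<tau> t) = subT (\<lambda>n. subT \<sigma> (\<tau> n)) t"
  by (induction t) auto

lemma subT_Var [simp]: "subT Var t = t"
  by (induction t) auto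

lemma upN_simps [simp]: "upN \<sigma> 0 = Var 0" "upN \<sigma> (Suc n) = shiftT (\<sigma> n)"
  by (auto simp: upN_def)

lemma upS_simps [simp]: "upS \<rho> 0 = 0" "upS \<rho> (Suc n) = Suc (\<rho> n)"
  by (auto simp: upS_def)

lemma subT_upN: "subT (upN \<sigma>) (upN \<tau> n) = upN (\<lambda>n. subT \<sigma> (\<tau> n)) n"
  by (cases n) (auto simp: shiftT_def subT_subT)

lemma upS_upS: "upS \<rho> (upS \<pi> n) = upS (\<lambda>n. \<rho> (\<pi> n)) n"
  by (cases n) auto

lemma sub_sub: "sub \<sigma> \<rho> (sub \<tau> \<pi> p) = sub (\<lambda>n. subT \<sigma> (\<tau> n)) (\<lambda>n. \<rho> (\<pi> n)) p"
  by (induction p arbitrary: \<sigma> \<rho> \<tau> \<pi>) (auto simp: subT_subT subT_upN upS_upS)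

lemma upN_Var [simp]: "upN Var = Var"
  by (rule ext, case_tac x) (auto simp: shiftT_def)

lemma upS_id [simp]: "upS id = id"
  by (rule ext, case_tac x) auto

lemma sub_Var [simp]: "sub Var id p = p"
proof (induction p)
  case (AllS p)
  then show ?case by (simp only: sub.simps upS_id)
qed simp_all

lemma boundT_subT_cong: "boundT k t \<Longrightarrow> (\<And>i. i < k \<Longrightarrow> \<sigma> i = \<tau> i) \<Longrightarrow> subT \<sigma> t = subT \<tau> t"
  by (induction t) auto

lemma bound_sub_cong:
  "bound k l p \<Longrightarrow> (\<And>i. i < k \<Longrightarrow> \<sigma> i = \<tau> i) \<Longrightarrow> (\<And>i. i < l \<Longrightarrow> \<rho> i = \<pi> i) \<Longrightarrow>
    sub \<sigma> \<rho> p = sub \<tau> \<pi> p"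
proof (induction p arbitrary: k l \<sigma> \<rho> \<tau> \<pi>)
  case (AllN p)
  have "upN \<sigma> i = upN \<tau> i" if "i < Suc k" for i
    using that AllN.prems(2) by (cases i) auto
  then show ?case
    using AllN.IH[of "Suc k" l "upN \<sigma>" "upN \<tau>" \<rho> \<pi>] AllN.prems by auto
next
  case (AllS p)
  have "upS \<rho> i = upS \<pi> i" if "i < Suc l" for i
    using that AllS.prems(3) by (cases i) auto
  then show ?case
    using AllS.IH[of k "Suc l" \<sigma> \<tau> "upS \<rho>" "upS \<pi>"] AllS.prems by auto
qed (simp; blast intro: boundT_subT_cong)+

lemma boundT_mono: "boundT k t \<Longrightarrow> k \<le> k' \<Longrightarrow> boundT k' t"
  by (induction t) auto

lemma bound_mono: "bound k l p \<Longrightarrow> k \<le> k' \<Longrightarrow> l \<le> l' \<Longrightarrow> bound k' l' p"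
proof (induction p arbitrary: k l k' l')
  case (AllN p)
  then show ?case using AllN.IH[of "Suc k" l "Suc k'" l'] by simp
next
  case (AllS p)
  then show ?case using AllS.IH[of k "Suc l" k' "Suc l'"] by simp
qed (auto intro: boundT_mono)

lemma boundT_exists: "\<exists>k. boundT k t"
proof (induction t)
  case (Add s t)
  then obtain k k' where "boundT k s" "boundT k' t" by blast
  then have "boundT (max k k') (Add s t)" by (auto intro: boundT_mono)
  then show ?case ..
next
  case (Mul s t)
  then obtain k k' where "boundT k s" "boundT k' t" by blast
  then have "boundT (max k k') (Mul s t)" by (auto intro: boundT_mono)
  then show ?case ..
qed auto

lemma boundT2_exists: "\<exists>k. boundT k s \<and> boundT k t"
  using boundT_exists[of "Add s t"] by simp

lemma bound_exists: "\<exists>n. bound n n p"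
proof (induction p)
  case (Eq s t)
  then show ?case using boundT2_exists[of s t] by simp
next
  case (Less s t)
  then show ?case using boundT2_exists[of s t] by simp
next
  case (Mem t X)
  obtain k where "boundT k t" using boundT_exists by blast
  then have "bound (max k (Suc X)) (max k (Suc X)) (Mem t X)" by (auto intro: boundT_mono)
  then show ?case ..
next
  case (Imp p q)
  then obtain k k' where "bound k k p" "bound k' k' q" by blast
  then have "bound (max k k') (max k k') (Imp p q)" by (auto intro: bound_mono)
  then show ?case ..
next
  case (AllN p)
  then obtain n where "bound n n p" ..
  then have "bound n n (AllN p)" by (auto intro: bound_mono)
  then show ?case ..
next
  case (AllS p)
  then obtain n where "bound n n p" ..
  then have "bound n n (AllS p)" by (auto intro: bound_mono)
  then show ?case ..
qed auto

lemma bound_exists_finite: "finite \<Gamma> \<Longrightarrow> \<exists>n. \<forall>q\<in>\<Gamma>. bound n n q"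
proof (induction rule: finite_induct)
  case (insert p \<Gamma>)
  then obtain k k' where "\<forall>q\<in>\<Gamma>. bound k k q" "bound k' k' p" using bound_exists by blast
  then have "\<forall>q\<in>insert p \<Gamma>. bound (max k k') (max k k') q" by (auto intro: bound_mono)
  then show ?case ..
qed auto

lemma sub_shiftN: "sub (upN \<sigma>) \<rho> (shiftN p) = shiftN (sub \<sigma> \<rho> p)"
  by (simp add: shiftN_def sub_sub) (simp add: shiftT_def)

lemma sub_shiftS: "sub \<sigma> (upS \<rho>) (shiftS p) = shiftS (sub \<sigma> \<rho> p)"
  by (simp add: shiftS_def sub_sub)

lemma sub_cong: "(\<And>i. \<sigma> i = \<tau> i) \<Longrightarrow> (\<And>i. \<rho> i = \<pi> i) \<Longrightarrow> sub \<sigma> \<rho> p = sub \<tau> \<pi> p"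
  by presburger

lemma subT_case_nat_upN [simp]: "subT (case_nat t \<tau>) (upN \<sigma> n) = case_nat t (\<lambda>n. subT \<tau> (\<sigma> n)) n"
  by (cases n) (auto simp: shiftT_def subT_subT)

lemma case_nat_comp_upS [simp]: "case_nat X \<pi> (upS \<rho> n) = case_nat X (\<lambda>n. \<pi> (\<rho> n)) n"
  by (cases n) auto

lemma sub_instN: "sub \<sigma> \<rho> (instN t p) = instN (subT \<sigma> t) (sub (upN \<sigma>) \<rho> p)"
  by (auto simp: instN_def sub_sub split: nat.split intro!: sub_cong)

lemma sub_instS: "sub \<sigma> \<rho> (instS X p) = instS (\<rho> X) (sub \<sigma> (upS \<rho>) p)"
  by (auto simp: instS_def sub_sub split: nat.split intro!: sub_cong)

lemma sub_Neg [simp]: "sub \<sigma> \<rho> (\<^bold>\<not> p) = (\<^bold>\<not> sub \<sigma> \<rho> p)"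
  by (simp add: Neg_def)

section \<open>Completeness\<close>

lemma prv_mono: "\<Gamma> \<turnstile> p \<Longrightarrow> \<Gamma> \<subseteq> \<Delta> \<Longrightarrow> \<Delta> \<turnstile> p"
proof (induction arbitrary: \<Delta> rule: prv.induct)
  case (ImpI p \<Gamma> q)
  then show ?case by (meson insert_mono prv.ImpI)
next
  case (RAA p \<Gamma>)
  then show ?case by (meson insert_mono prv.RAA)
next
  case (AllNI \<Gamma> p)
  then show ?case by (meson image_mono prv.AllNI)
next
  case (AllSI \<Gamma> p)
  then show ?case by (meson image_mono prv.AllSI)
qed (blast intro: prv.intros)+

text \<open>Derivations are finite; this is what keeps the union of the Henkin chain consistent. In
  the quantifier rules a finite set of shifted formulas is pulled back to a finite set of unshifted
  ones.\<close>

lemma prv_finite: "\<Gamma> \<turnstile> p \<Longrightarrow> \<exists>\<Delta>. finite \<Delta> \<and> \<Delta> \<subseteq> \<Gamma> \<and> (\<Delta> \<turnstile> p)"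
proof (induction rule: prv.induct)
  case (Assm p \<Gamma>)
  then show ?case by (intro exI[of _ "{p}"]) (auto intro: prv.Assm)
next
  case (ImpI p \<Gamma> q)
  then obtain \<Delta> where \<Delta>: "finite \<Delta>" "\<Delta> \<subseteq> insert p \<Gamma>" "\<Delta> \<turnstile> q" by blast
  then have "insert p (\<Delta> - {p}) \<turnstile> q" by (elim prv_mono) auto
  then show ?case using \<Delta>(1,2) by (intro exI[of _ "\<Delta> - {p}"]) (auto intro: prv.ImpI)
next
  case (ImpE \<Gamma> p q)
  then obtain \<Delta> \<Delta>' where \<Delta>: "finite \<Delta>" "\<Delta> \<subseteq> \<Gamma>" "\<Delta> \<turnstile> p \<^bold>\<longrightarrow> q" "finite \<Delta>'" "\<Delta>' \<subseteq> \<Gamma>" "\<Delta>' \<turnstile> p"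
    by blast
  then have "\<Delta> \<union> \<Delta>' \<turnstile> p \<^bold>\<longrightarrow> q" "\<Delta> \<union> \<Delta>' \<turnstile> p" using prv_mono by (metis Un_upper1, metis Un_upper2)
  then have "\<Delta> \<union> \<Delta>' \<turnstile> q" by (rule prv.ImpE)
  then show ?case using \<Delta> by (intro exI[of _ "\<Delta> \<union> \<Delta>'"]) simp
next
  case (RAA p \<Gamma>)
  then obtain \<Delta> where \<Delta>: "finite \<Delta>" "\<Delta> \<subseteq> insert (\<^bold>\<not> p) \<Gamma>" "\<Delta> \<turnstile> \<^bold>\<bottom>" by blast
  then have "insert (\<^bold>\<not> p) (\<Delta> - {\<^bold>\<not> p}) \<turnstile> \<^bold>\<bottom>" by (elim prv_mono) auto
  then show ?case using \<Delta>(1,2) by (intro exI[of _ "\<Delta> - {\<^bold>\<not> p}"]) (auto intro: prv.RAA)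
next
  case (AllNI \<Gamma> p)
  then obtain \<Delta> where "finite \<Delta>" "\<Delta> \<subseteq> \<Gamma>" "shiftN ` \<Delta> \<turnstile> p" by (metis finite_subset_image)
  then show ?case using prv.AllNI by blast
next
  case (AllNE \<Gamma> p t)
  then show ?case using prv.AllNE by blast
next
  case (AllSI \<Gamma> p)
  then obtain \<Delta> where "finite \<Delta>" "\<Delta> \<subseteq> \<Gamma>" "shiftS ` \<Delta> \<turnstile> p" by (metis finite_subset_image)
  then show ?case using prv.AllSI by blast
next
  case (AllSE \<Gamma> p X)
  then show ?case using prv.AllSE by blast
next
  case (EqRefl \<Gamma> t)
  show ?case by (intro exI[of _ "{}"]) (auto intro: prv.EqRefl)
next
  case (EqSubst \<Gamma> s t p)
  then obtain \<Delta> \<Delta>' where \<Delta>: "finite \<Delta>" "\<Delta> \<subseteq> \<Gamma>" "\<Delta> \<turnstile> s \<^bold>= t" "finite \<Delta>'" "\<Delta>' \<subseteq> \<Gamma>"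
    "\<Delta>' \<turnstile> instN s p" by blast
  then have "\<Delta> \<union> \<Delta>' \<turnstile> s \<^bold>= t" "\<Delta> \<union> \<Delta>' \<turnstile> instN s p" using prv_mono by (metis Un_upper1, metis Un_upper2)
  then have "\<Delta> \<union> \<Delta>' \<turnstile> instN t p" by (rule prv.EqSubst)
  then show ?case using \<Delta> by (intro exI[of _ "\<Delta> \<union> \<Delta>'"]) simp
qed

text \<open>The tool for renaming eigenvariables. The substitution is kept arbitrary in the
  induction because it is lifted under each quantifier.\<close>

lemma prv_sub: "\<Gamma> \<turnstile> p \<Longrightarrow> sub \<sigma> \<rho> ` \<Gamma> \<turnstile> sub \<sigma> \<rho> p"
proof (induction arbitrary: \<sigma> \<rho> rule: prv.induct)
  case (Assm p \<Gamma>)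
  then show ?case by (auto intro: prv.Assm)
next
  case (ImpI p \<Gamma> q)
  then show ?case by (auto intro: prv.ImpI)
next
  case (ImpE \<Gamma> p q)
  then show ?case by (metis prv.ImpE sub.simps(5))
next
  case (RAA p \<Gamma>)
  then show ?case by (auto intro: prv.RAA)
next
  case (AllNI \<Gamma> p)
  then show ?case
    using AllNI.IH[of "upN \<sigma>" \<rho>] by (auto intro!: prv.AllNI simp: image_image sub_shiftN)
next
  case (AllNE \<Gamma> p t)
  then show ?case
    using AllNE.IH[of \<sigma> \<rho>] by (auto simp: sub_instN intro!: prv.AllNE)
next
  case (AllSI \<Gamma> p)
  then show ?case
    using AllSI.IH[of \<sigma> "upS \<rho>"] by (auto intro!: prv.AllSI simp: image_image sub_shiftS)
next
  case (AllSE \<Gamma> p t)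
  then show ?case
    using AllSE.IH[of \<sigma> \<rho>] by (auto simp: sub_instS intro!: prv.AllSE)
next
  case (EqRefl \<Gamma> t)
  then show ?case by (auto intro: prv.EqRefl)
next
  case (EqSubst \<Gamma> s t p)
  then show ?case
    using prv.EqSubst[of "sub \<sigma> \<rho> ` \<Gamma>" "subT \<sigma> s" "subT \<sigma> t" "sub (upN \<sigma>) \<rho> p"] by (simp add: sub_instN)
qed

text \<open>The free variables of the language serve as Henkin constants.\<close>

lemma prv_AllN_fresh:
  assumes \<Gamma>: "\<forall>q\<in>\<Gamma>. bound n l q" and p: "bound (Suc n) l p" and prv: "\<Gamma> \<turnstile> instN (Var n) p"
  shows "\<Gamma> \<turnstile> AllN p"
proof -
  \<comment> \<open>Variable \<open>n\<close> moves to position 0 and every other index goes up by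
    one. On formulas with free number variables below \<open>n\<close> this is
    \<open>shiftN\<close>, and it turns the instance of \<open>p\<close> at \<open>Var n\<close>
    back into \<open>p\<close>, which is the premise of \<open>AllNI\<close>.\<close>
  define \<sigma> where "\<sigma> = (\<lambda>i. if i = n then Var 0 else Var (Suc i))"
  have "sub \<sigma> id q = shiftN q" if "q \<in> \<Gamma>" for q
    unfolding shiftN_def by (rule bound_sub_cong[OF \<Gamma>[rule_format, OF that]]) (auto simp: \<sigma>_def)
  then have "sub \<sigma> id ` \<Gamma> = shiftN ` \<Gamma>" by auto
  moreover have "sub \<sigma> id (instN (Var n) p) = sub (case_nat (Var 0) \<sigma>) id p"
    unfolding instN_def sub_sub by (rule sub_cong) (auto simp: \<sigma>_def split: nat.split)
  moreover have "\<dots> = sub Var id p"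
    by (rule bound_sub_cong[OF p]) (auto simp: \<sigma>_def split: nat.split)
  ultimately show ?thesis
    using prv_sub[OF prv, of \<sigma> id] by (auto intro: prv.AllNI)
qed

lemma prv_AllS_fresh:
  assumes \<Gamma>: "\<forall>q\<in>\<Gamma>. bound k n q" and p: "bound k (Suc n) p" and prv: "\<Gamma> \<turnstile> instS n p"
  shows "\<Gamma> \<turnstile> AllS p"
proof -
  define \<rho> where "\<rho> = (\<lambda>i. if i = n then 0 else Suc i)"
  have "sub Var \<rho> q = shiftS q" if "q \<in> \<Gamma>" for q
    unfolding shiftS_def by (rule bound_sub_cong[OF \<Gamma>[rule_format, OF that]]) (auto simp: \<rho>_def)
  then have "sub Var \<rho> ` \<Gamma> = shiftS ` \<Gamma>" by auto
  moreover have "sub Var \<rho> (instS n p) = sub Var (case_nat 0 \<rho>) p"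
    unfolding instS_def sub_sub by (rule sub_cong) (auto simp: \<rho>_def split: nat.split)
  moreover have "\<dots> = sub Var id p"
    by (rule bound_sub_cong[OF p]) (auto simp: \<rho>_def split: nat.split)
  ultimately show ?thesis
    using prv_sub[OF prv, of Var \<rho>] by (auto intro: prv.AllSI)
qed

section \<open>Henkin extensions of consistent sets of sentences\<close>

definition consistent :: "fm set \<Rightarrow> bool" where
  "consistent \<Gamma> \<longleftrightarrow> \<not> (\<Gamma> \<turnstile> \<^bold>\<bottom>)"

lemma consistent_cases: "consistent \<Gamma> \<Longrightarrow> consistent (insert q \<Gamma>) \<or> consistent (insert (\<^bold>\<not> q) \<Gamma>)"
  unfolding consistent_def by (metis ImpE ImpI Neg_def RAA)

lemma consistent_witnessN:
  assumes "consistent \<Gamma>" "(\<^bold>\<not> AllN p) \<in> \<Gamma>" "\<forall>q\<in>\<Gamma>. bound n n q"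
  shows "consistent (insert (\<^bold>\<not> instN (Var n) p) \<Gamma>)"
proof (rule ccontr)
  assume "\<not> ?thesis"
  then have "\<Gamma> \<turnstile> instN (Var n) p" by (auto simp: consistent_def intro: prv.RAA)
  moreover have "bound (Suc n) n p" using assms(2,3) by (auto simp: Neg_def)
  ultimately have "\<Gamma> \<turnstile> AllN p" using assms(3) prv_AllN_fresh by blast
  then show False using assms(1,2) unfolding consistent_def Neg_def by (meson prv.Assm prv.ImpE)
qed

lemma consistent_witnessS:
  assumes "consistent \<Gamma>" "(\<^bold>\<not> AllS p) \<in> \<Gamma>" "\<forall>q\<in>\<Gamma>. bound n n q"
  shows "consistent (insert (\<^bold>\<not> instS n p) \<Gamma>)"
proof (rule ccontr)
  assume "\<not> ?thesis"
  then have "\<Gamma> \<turnstile> instS n p" by (auto simp: consistent_def intro: prv.RAA)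
  moreover have "bound n (Suc n) p" using assms(2,3) by (auto simp: Neg_def)
  ultimately have "\<Gamma> \<turnstile> AllS p" using assms(3) prv_AllS_fresh by blast
  then show False using assms(1,2) unfolding consistent_def Neg_def by (meson prv.Assm prv.ImpE)
qed

text \<open>Completeness and the Henkin witness property for one formula at a time, so that a single
  enumeration of all formulas takes care of both.\<close>

definition decides :: "fm set \<Rightarrow> fm \<Rightarrow> bool" where
  "decides \<Delta> q \<longleftrightarrow> (q \<in> \<Delta> \<or> (\<^bold>\<not> q) \<in> \<Delta>) \<and>
    (\<forall>p. q = AllN p \<longrightarrow> (\<^bold>\<not> q) \<in> \<Delta> \<longrightarrow> (\<exists>t. (\<^bold>\<not> instN t p) \<in> \<Delta>)) \<and>
    (\<forall>p. q = AllS p \<longrightarrow> (\<^bold>\<not> q) \<in> \<Delta> \<longrightarrow> (\<exists>X. (\<^bold>\<not> instS X p) \<in> \<Delta>))"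

lemma consistent_decide:
  assumes T: "\<forall>q\<in>T. bound 0 0 q" and \<Delta>: "finite \<Delta>" "consistent (T \<union> \<Delta>)"
  shows "\<exists>\<Delta>'. finite \<Delta>' \<and> consistent (T \<union> \<Delta>') \<and> \<Delta> \<subseteq> \<Delta>' \<and> decides \<Delta>' q"
proof (cases "consistent (insert (\<^bold>\<not> q) (T \<union> \<Delta>))")
  case False
  then have "consistent (T \<union> insert q \<Delta>)" using consistent_cases[OF \<Delta>(2), of q] by auto
  \<comment> \<open>Makes the two witness clauses of \<open>decides\<close> vacuous: had the
    negation been present already, adding it would not have destroyed consistency.\<close>
  moreover have "(\<^bold>\<not> q) \<notin> insert q \<Delta>"
  proof
    assume "(\<^bold>\<not> q) \<in> insert q \<Delta>"
    moreover have "(\<^bold>\<not> q) \<noteq> q" unfolding Neg_def by (induction q) auto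
    ultimately have "insert (\<^bold>\<not> q) (T \<union> \<Delta>) = T \<union> \<Delta>" by auto
    then show False using False \<Delta> by simp
  qed
  ultimately show ?thesis using \<Delta>(1)
    by (intro exI[of _ "insert q \<Delta>"]) (auto simp: decides_def)
next
  case True
  define \<Gamma> where "\<Gamma> = insert (\<^bold>\<not> q) \<Delta>"
  have fin: "finite \<Gamma>" and consistent: "consistent (T \<union> \<Gamma>)" and q: "(\<^bold>\<not> q) \<in> \<Gamma>" and sub: "\<Delta> \<subseteq> \<Gamma>"
    using \<Delta> True by (auto simp: \<Gamma>_def)
  \<comment> \<open>\<open>T\<close> consists of sentences and \<open>\<Gamma>\<close> is finite, so
    one index \<open>n\<close> is fresh in both sorts.\<close>
  obtain n where "\<forall>q\<in>\<Gamma>. bound n n q" using bound_exists_finite[OF fin] by blast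
  then have n: "\<forall>q\<in>T \<union> \<Gamma>. bound n n q" using T by (auto intro: bound_mono)
  consider p where "q = AllN p" | p where "q = AllS p" | "\<And>p. q \<noteq> AllN p \<and> q \<noteq> AllS p" by blast
  then show ?thesis
  proof cases
    case 1
    then have "consistent (T \<union> insert (\<^bold>\<not> instN (Var n) p) \<Gamma>)"
      using consistent_witnessN[OF consistent _ n] q by auto
    then show ?thesis using 1 fin q sub
      by (intro exI[of _ "insert (\<^bold>\<not> instN (Var n) p) \<Gamma>"]) (auto simp: decides_def)
  next
    case 2
    then have "consistent (T \<union> insert (\<^bold>\<not> instS n p) \<Gamma>)"
      using consistent_witnessS[OF consistent _ n] q by auto
    then show ?thesis using 2 fin q sub
      by (intro exI[of _ "insert (\<^bold>\<not> instS n p) \<Gamma>"]) (auto simp: decides_def)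
  next
    case 3
    then show ?thesis using consistent fin q sub
      by (intro exI[of _ \<Gamma>]) (auto simp: decides_def)
  qed
qed

instance tm :: countable by countable_datatype
instance fm :: countable by countable_datatype

text \<open>The formula with number \<open>n\<close> is decided on passing from stage
  \<open>n\<close> to the next. Every stage adds only finitely many formulas to the sentences of
  \<open>T\<close>, so fresh variables never run out.\<close>

lemma henkin_extension:
  assumes T: "\<forall>q\<in>T. bound 0 0 q" "consistent T"
  shows "\<exists>H. T \<subseteq> H \<and> consistent H \<and> (\<forall>q. decides H q)"
proof -
  have "\<exists>D. \<forall>n. (finite (D n) \<and> consistent (T \<union> D n)) \<and> (D n \<subseteq> D (Suc n) \<and> decides (D (Suc n)) (from_nat n))"
  proof (rule dependent_nat_choice)
    show "\<exists>\<Delta>. finite \<Delta> \<and> consistent (T \<union> \<Delta>)" using T(2) by (intro exI[of _ "{}"]) simp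
    show "\<exists>\<Delta>'. (finite \<Delta>' \<and> consistent (T \<union> \<Delta>')) \<and> \<Delta> \<subseteq> \<Delta>' \<and> decides \<Delta>' (from_nat n)"
      if "finite \<Delta> \<and> consistent (T \<union> \<Delta>)" for \<Delta> n
      using consistent_decide[OF T(1), of \<Delta> "from_nat n"] that by metis
  qed
  then obtain D where D: "\<And>n. finite (D n)" "\<And>n. consistent (T \<union> D n)" "\<And>n. D n \<subseteq> D (Suc n)"
    "\<And>n. decides (D (Suc n)) (from_nat n)" by blast
  have mono: "D m \<subseteq> D n" if "m \<le> n" for m n
    using that D(3) by (rule lift_Suc_mono_le[rotated])
  define H where "H = T \<union> (\<Union>n. D n)"
  have chain: "\<exists>n. \<Delta> \<subseteq> T \<union> D n" if "finite \<Delta>" "\<Delta> \<subseteq> H" for \<Delta>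
    using that
  proof (induction rule: finite_induct)
    case (insert q \<Delta>)
    then obtain n m where "\<Delta> \<subseteq> T \<union> D n" "q \<in> T \<union> D m" by (auto simp: H_def)
    then have "insert q \<Delta> \<subseteq> T \<union> D (max m n)" using mono[of n "max m n"] mono[of m "max m n"] by auto
    then show ?case ..
  qed auto
  have consistent: "consistent H"
    unfolding consistent_def
  proof
    assume "H \<turnstile> \<^bold>\<bottom>"
    then obtain \<Delta> where "finite \<Delta>" "\<Delta> \<subseteq> H" "\<Delta> \<turnstile> \<^bold>\<bottom>" using prv_finite by blast
    moreover obtain n where "\<Delta> \<subseteq> T \<union> D n" using chain calculation by blast
    ultimately show False using D(2)[of n] prv_mono[of \<Delta> "\<^bold>\<bottom>" "T \<union> D n"] unfolding consistent_def by simp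
  qed
  have "decides H q" for q
  proof -
    obtain n where "q = from_nat n" by (metis from_nat_to_nat)
    then have d: "decides (D (Suc n)) q" using D(4) by simp
    have sub: "D (Suc n) \<subseteq> H" by (auto simp: H_def)
    \<comment> \<open>\<open>decides\<close> is not monotone: the negation of \<open>q\<close> could
      enter without a witness after \<open>q\<close> itself was chosen. Consistency of
      \<open>H\<close> excludes this.\<close>
    have no: "\<not> (q \<in> H \<and> (\<^bold>\<not> q) \<in> H)"
      using consistent unfolding consistent_def Neg_def by (meson prv.Assm prv.ImpE)
    show ?thesis using d sub no unfolding decides_def by blast
  qed
  then show ?thesis using consistent H_def by blast
qed

section \<open>Satisfaction in two-sorted structures\<close>

locale L2_structure =
  fixes zero one :: 'a and add mul :: "'a \<Rightarrow> 'a \<Rightarrow> 'a" and less :: "'a \<Rightarrow> 'a \<Rightarrow> bool"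
    and mem :: "'a \<Rightarrow> 'b \<Rightarrow> bool"
begin

primrec evT :: "(nat \<Rightarrow> 'a) \<Rightarrow> tm \<Rightarrow> 'a" where
  "evT e (Var n) = e n"
| "evT e \<^bold>0 = zero"
| "evT e \<^bold>1 = one"
| "evT e (s \<^bold>+ t) = add (evT e s) (evT e t)"
| "evT e (s \<^bold>\<times> t) = mul (evT e s) (evT e t)"

primrec sat :: "(nat \<Rightarrow> 'a) \<Rightarrow> (nat \<Rightarrow> 'b) \<Rightarrow> fm \<Rightarrow> bool" where
  "sat e S (s \<^bold>= t) \<longleftrightarrow> evT e s = evT e t"
| "sat e S (s \<^bold>< t) \<longleftrightarrow> less (evT e s) (evT e t)"
| "sat e S (t \<^bold>\<in> X) \<longleftrightarrow> mem (evT e t) (S X)"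
| "sat e S \<^bold>\<bottom> \<longleftrightarrow> False"
| "sat e S (p \<^bold>\<longrightarrow> q) \<longleftrightarrow> (sat e S p \<longrightarrow> sat e S q)"
| "sat e S (AllN p) \<longleftrightarrow> (\<forall>x. sat (case_nat x e) S p)"
| "sat e S (AllS p) \<longleftrightarrow> (\<forall>X. sat e (case_nat X S) p)"

lemma sat_simps [simp]:
  "sat e S (\<^bold>\<not> p) \<longleftrightarrow> \<not> sat e S p"
  "sat e S (p \<^bold>\<or> q) \<longleftrightarrow> sat e S p \<or> sat e S q"
  "sat e S (p \<^bold>\<and> q) \<longleftrightarrow> sat e S p \<and> sat e S q"
  "sat e S (p \<^bold>\<longleftrightarrow> q) \<longleftrightarrow> (sat e S p \<longleftrightarrow> sat e S q)"
  "sat e S (ExN p) \<longleftrightarrow> (\<exists>x. sat (case_nat x e) S p)"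
  "sat e S (ExS p) \<longleftrightarrow> (\<exists>X. sat e (case_nat X S) p)"
  by (auto simp: Neg_def Or_def And_def Iff_def ExN_def ExS_def)

lemma evT_subT: "evT e (subT \<sigma> t) = evT (\<lambda>n. evT e (\<sigma> n)) t"
  by (induction t) auto

lemma evT_shiftT [simp]: "evT (case_nat x e) (shiftT t) = evT e t"
  by (simp add: shiftT_def evT_subT)

lemma evT_upN: "(\<lambda>n. evT (case_nat x e) (upN \<sigma> n)) = case_nat x (\<lambda>n. evT e (\<sigma> n))"
  by (rule ext, case_tac n) auto

lemma case_nat_upS: "(\<lambda>n. case_nat X S (upS \<rho> n)) = case_nat X (\<lambda>n. S (\<rho> n))"
  by (rule ext, case_tac n) auto

lemma sat_sub: "sat e S (sub \<sigma> \<rho> p) \<longleftrightarrow> sat (\<lambda>n. evT e (\<sigma> n)) (\<lambda>n. S (\<rho> n)) p"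
  by (induction p arbitrary: e S \<sigma> \<rho>) (auto simp: evT_subT evT_upN case_nat_upS simp del: case_nat_comp_upS)

lemma sat_AllB [simp]: "sat e S (AllB t p) \<longleftrightarrow> (\<forall>x. less x (evT e t) \<longrightarrow> sat (case_nat x e) S p)"
  by (simp add: AllB_def)

lemma sat_ExB [simp]: "sat e S (ExB t p) \<longleftrightarrow> (\<exists>x. less x (evT e t) \<and> sat (case_nat x e) S p)"
  by (simp add: ExB_def)

lemma boundT_cong: "boundT k t \<Longrightarrow> (\<And>i. i < k \<Longrightarrow> e i = e' i) \<Longrightarrow> evT e t = evT e' t"
  by (induction t) auto

lemma bound_cong:
  "bound k l p \<Longrightarrow> (\<And>i. i < k \<Longrightarrow> e i = e' i) \<Longrightarrow> (\<And>i. i < l \<Longrightarrow> S i = S' i) \<Longrightarrow>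
    sat e S p \<longleftrightarrow> sat e' S' p"
proof (induction p arbitrary: k l e e' S S')
  case (Eq s t)
  then show ?case using boundT_cong[of k _ e e'] by simp
next
  case (Less s t)
  then show ?case using boundT_cong[of k _ e e'] by simp
next
  case (Mem t X)
  then show ?case using boundT_cong[of k _ e e'] by simp
next
  case (Imp p q)
  have "sat e S p \<longleftrightarrow> sat e' S' p" "sat e S q \<longleftrightarrow> sat e' S' q"
    by (rule Imp.IH[of k l]; use Imp.prems in simp)+
  then show ?case by simp
next
  case (AllN p)
  have "sat (case_nat x e) S p \<longleftrightarrow> sat (case_nat x e') S' p" for x
    by (rule AllN.IH[of "Suc k" l]) (use AllN.prems in \<open>auto split: nat.split\<close>)
  then show ?case by simp
next
  case (AllS p)
  have "sat e (case_nat X S) p \<longleftrightarrow> sat e' (case_nat X S') p" for X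
    by (rule AllS.IH[of k "Suc l"]) (use AllS.prems in \<open>auto split: nat.split\<close>)
  then show ?case by simp
qed auto

lemma sat_AllN_power: "sat e S ((AllN ^^ k) p) \<longleftrightarrow> (\<forall>e'. (\<forall>i. e' (i + k) = e i) \<longrightarrow> sat e' S p)"
proof (induction k arbitrary: p)
  case 0
  have "e' = e" if "\<And>i. e' i = e i" for e' using that by auto
  then show ?case by auto
next
  case (Suc k)
  have "(\<forall>e'. (\<forall>i. e' (i + k) = e i) \<longrightarrow> (\<forall>x. sat (case_nat x e') S p)) \<longleftrightarrow>
    (\<forall>e'. (\<forall>i. e' (i + Suc k) = e i) \<longrightarrow> sat e' S p)" (is "?l \<longleftrightarrow> ?r")
  proof
    assume l: ?l
    show ?r
    proof (intro allI impI)
      fix e' assume "\<forall>i. e' (i + Suc k) = e i"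
      then have "sat (case_nat (e' 0) (\<lambda>i. e' (Suc i))) S p" using l by simp
      moreover have "case_nat (e' 0) (\<lambda>i. e' (Suc i)) = e'" by (auto split: nat.split)
      ultimately show "sat e' S p" by simp
    qed
  qed auto
  moreover have "(AllN ^^ Suc k) p = (AllN ^^ k) (AllN p)" by (simp add: funpow_swap1)
  ultimately show ?case by (simp only: Suc[of "AllN p"] sat.simps)
qed

lemma sat_AllS_power: "sat e S ((AllS ^^ k) p) \<longleftrightarrow> (\<forall>S'. (\<forall>i. S' (i + k) = S i) \<longrightarrow> sat e S' p)"
proof (induction k arbitrary: p)
  case 0
  have "S' = S" if "\<And>i. S' i = S i" for S' using that by auto
  then show ?case by auto
next
  case (Suc k)
  have "(\<forall>S'. (\<forall>i. S' (i + k) = S i) \<longrightarrow> (\<forall>x. sat e (case_nat x S') p)) \<longleftrightarrow>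
    (\<forall>S'. (\<forall>i. S' (i + Suc k) = S i) \<longrightarrow> sat e S' p)" (is "?l \<longleftrightarrow> ?r")
  proof
    assume l: ?l
    show ?r
    proof (intro allI impI)
      fix S' assume "\<forall>i. S' (i + Suc k) = S i"
      then have "sat e (case_nat (S' 0) (\<lambda>i. S' (Suc i))) p" using l by simp
      moreover have "case_nat (S' 0) (\<lambda>i. S' (Suc i)) = S'" by (auto split: nat.split)
      ultimately show "sat e S' p" by simp
    qed
  qed auto
  moreover have "(AllS ^^ Suc k) p = (AllS ^^ k) (AllS p)" by (simp add: funpow_swap1)
  ultimately show ?case by (simp only: Suc[of "AllS p"] sat.simps)
qed

text \<open>Closing \<open>p\<close> with \<open>n\<close> quantifiers of each sort,
  \<open>n\<close> above all its free variables, makes the starting assignment irrelevant; the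
  axioms may then be used with arbitrary parameters.\<close>

lemma sat_closures:
  assumes "\<And>q. q \<in> closures F \<Longrightarrow> sat e\<^sub>0 S\<^sub>0 q" and p: "p \<in> F"
  shows "sat e S p"
proof -
  obtain n where n: "bound n n p" using bound_exists by blast
  then have "(AllS ^^ n) ((AllN ^^ n) p) \<in> closures F" using p by (auto simp: closures_def)
  then have all: "sat e\<^sub>0 S\<^sub>0 ((AllS ^^ n) ((AllN ^^ n) p))" by (rule assms(1))
  \<comment> \<open>Below \<open>n\<close> the wanted values, from \<open>n\<close> on a shifted
    copy of the given assignment: the shape that the lemmas on quantifier blocks require.
    \<open>bound_cong\<close> then ignores the tail.\<close>
  define e' S' where "e' = (\<lambda>i. if i < n then e i else e\<^sub>0 (i - n))"
    and "S' = (\<lambda>i. if i < n then S i else S\<^sub>0 (i - n))"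
  have "sat e\<^sub>0 S' ((AllN ^^ n) p)" using all by (simp add: sat_AllS_power S'_def)
  then have "sat e' S' p" by (simp add: sat_AllN_power e'_def)
  then show ?thesis by (subst bound_cong[OF n, of e e' S S']) (auto simp: e'_def S'_def)
qed

end

section \<open>Closed theories and the term model\<close>

lemma bound_AllN_power: "bound k l ((AllN ^^ n) p) \<longleftrightarrow> bound (k + n) l p"
  by (induction n arbitrary: k) auto

lemma bound_AllS_power: "bound k l ((AllS ^^ n) p) \<longleftrightarrow> bound k (l + n) p"
  by (induction n arbitrary: l) auto

lemma closures_closed: "q \<in> closures F \<Longrightarrow> bound 0 0 q"
  by (auto simp: closures_def bound_AllN_power bound_AllS_power)

text \<open>The successor axioms force infinitely many classes of terms modulo provable equality, so
  that the number sort of the term model can be the type \<^typ>\<open>nat\<close>.\<close>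

theorem model_existence:
  assumes closed: "\<forall>q\<in>T. bound 0 0 q" and "consistent T"
    and succ: "(AllN ^^ 2) (\<^bold>\<not> (Var 1 \<^bold>+ \<^bold>1 \<^bold>= \<^bold>0)) \<in> T"
      "(AllN ^^ 2) (Var 0 \<^bold>+ \<^bold>1 \<^bold>= Var 1 \<^bold>+ \<^bold>1 \<^bold>\<longrightarrow> Var 0 \<^bold>= Var 1) \<in> T"
  obtains zero one :: nat and add mul less and mem :: "nat \<Rightarrow> nat \<Rightarrow> bool"
  where "\<And>e S q. q \<in> T \<Longrightarrow> L2_structure.sat zero one add mul less mem e S q"
proof -
  obtain H where TH: "T \<subseteq> H" and consistent: "consistent H" and dec: "\<And>q. decides H q"
    using henkin_extension[OF closed \<open>consistent T\<close>] by (elim exE conjE) simp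
  have mp: "q \<in> H" if "(p \<^bold>\<longrightarrow> q) \<in> H" "p \<in> H" for p q
  proof (rule ccontr)
    assume "q \<notin> H"
    then have "(q \<^bold>\<longrightarrow> \<^bold>\<bottom>) \<in> H" using dec[of q] by (auto simp: decides_def Neg_def)
    then show False using consistent that unfolding consistent_def by (meson prv.Assm prv.ImpE)
  qed
  have prvH: "(H \<turnstile> q) \<longleftrightarrow> q \<in> H" for q
  proof
    assume "H \<turnstile> q"
    show "q \<in> H"
    proof (rule ccontr)
      assume "q \<notin> H"
      then have "(q \<^bold>\<longrightarrow> \<^bold>\<bottom>) \<in> H" using dec[of q] by (auto simp: decides_def Neg_def)
      then show False using consistent \<open>H \<turnstile> q\<close> unfolding consistent_def by (meson prv.Assm prv.ImpE)
    qed
  qed (rule prv.Assm)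
  have Bot: "\<^bold>\<bottom> \<notin> H" using consistent by (auto simp: consistent_def prvH)
  have Neg: "(\<^bold>\<not> q) \<in> H \<longleftrightarrow> q \<notin> H" for q
    using mp[of q "\<^bold>\<bottom>"] Bot dec[of q] by (auto simp: decides_def Neg_def)
  have Imp: "(p \<^bold>\<longrightarrow> q) \<in> H \<longleftrightarrow> (p \<in> H \<longrightarrow> q \<in> H)" for p q
  proof (intro iffI impI)
    assume pq: "p \<in> H \<longrightarrow> q \<in> H"
    have "insert p H \<turnstile> q"
    proof (cases "p \<in> H")
      case True
      then show ?thesis using pq by (auto intro: prv.Assm)
    next
      case False
      then have "insert (\<^bold>\<not> q) (insert p H) \<turnstile> p \<^bold>\<longrightarrow> \<^bold>\<bottom>"
        using Neg[of p] by (auto intro: prv.Assm simp: Neg_def)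
      moreover have "insert (\<^bold>\<not> q) (insert p H) \<turnstile> p" by (auto intro: prv.Assm)
      ultimately show ?thesis by (blast intro: prv.RAA prv.ImpE)
    qed
    then show "(p \<^bold>\<longrightarrow> q) \<in> H" using prvH prv.ImpI by blast
  qed (blast intro: mp)
  have H_AllN: "AllN p \<in> H \<longleftrightarrow> (\<forall>t. instN t p \<in> H)" for p
  proof
    assume "AllN p \<in> H"
    then show "\<forall>t. instN t p \<in> H" using prvH prv.AllNE by blast
  next
    assume "\<forall>t. instN t p \<in> H"
    then show "AllN p \<in> H" using dec[of "AllN p"] Neg by (auto simp: decides_def)
  qed
  have H_AllS: "AllS p \<in> H \<longleftrightarrow> (\<forall>X. instS X p \<in> H)" for p
  proof
    assume "AllS p \<in> H"
    then show "\<forall>X. instS X p \<in> H" using prvH prv.AllSE by blast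
  next
    assume "\<forall>X. instS X p \<in> H"
    then show "AllS p \<in> H" using dec[of "AllS p"] Neg by (auto simp: decides_def)
  qed

  define eq where "eq = (\<lambda>s t. (s \<^bold>= t) \<in> H)"
  have refl: "eq t t" for t unfolding eq_def using prvH prv.EqRefl by blast
  have subst: "instN t p \<in> H" if "eq s t" "instN s p \<in> H" for s t p
    using that prv.EqSubst[of H s t p] unfolding eq_def prvH by blast
  \<comment> \<open>The left side of the auxiliary equation is shifted and so survives
    instantiation; only the occurrences in \<open>u\<close> change from \<open>s\<close> to
    \<open>t\<close>.\<close>
  have ctxt: "eq (subT (case_nat s Var) u) (subT (case_nat t Var) u)" if "eq s t" for s t u
    using subst[OF that, of "shiftT (subT (case_nat s Var) u) \<^bold>= u"] refl
    by (simp add: instN_def eq_def shiftT_def subT_subT)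
  have sym: "eq t s" if "eq s t" for s t
    using subst[OF that, of "Var 0 \<^bold>= shiftT s"] refl[of s]
    by (simp add: instN_def eq_def shiftT_def subT_subT)
  have trans: "eq s u" if "eq s t" "eq t u" for s t u
    using subst[OF that(2), of "shiftT s \<^bold>= Var 0"] that(1)
    by (simp add: instN_def eq_def shiftT_def subT_subT)
  define rep where "rep = (\<lambda>t. SOME s. eq t s)"
  have rep: "eq t (rep t)" for t unfolding rep_def using refl by (rule someI)
  have rep_eq: "rep s = rep t \<longleftrightarrow> eq s t" for s t
  proof
    assume "rep s = rep t"
    then show "eq s t" using rep[of s] rep[of t] sym trans by metis
  next
    assume "eq s t"
    then have "eq s = eq t" using sym trans by blast
    then show "rep s = rep t" by (simp add: rep_def)
  qed
  have rep_rep: "rep (rep t) = rep t" for t using rep rep_eq sym by blast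
  have inst2: "sub (case_nat s (case_nat t Var)) id q \<in> H" if "(AllN ^^ 2) q \<in> T" for s t q
  proof -
    have "instN t (AllN q) \<in> H" using that TH H_AllN by (auto simp: numeral_2_eq_2)
    then have "instN s (sub (upN (case_nat t Var)) id q) \<in> H" using H_AllN by (simp add: instN_def)
    moreover have "instN s (sub (upN (case_nat t Var)) id q) = sub (case_nat s (case_nat t Var)) id q"
      by (auto simp: instN_def sub_sub intro!: sub_cong split: nat.split)
    ultimately show ?thesis by simp
  qed
  have succ_neq_0: "\<not> eq (t \<^bold>+ \<^bold>1) \<^bold>0" for t
    using inst2[OF succ(1), of _ t] by (simp add: Neg eq_def)
  have succ_inj: "eq s t" if "eq (s \<^bold>+ \<^bold>1) (t \<^bold>+ \<^bold>1)" for s t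
    using inst2[OF succ(2), of s t] that by (simp add: Imp eq_def)
  \<comment> \<open>Successor induces an injective map on classes that misses the class of zero,
    which is impossible on a finite set.\<close>
  have inf: "infinite (range rep)"
  proof
    assume fin: "finite (range rep)"
    let ?f = "\<lambda>t. rep (t \<^bold>+ \<^bold>1)"
    have "inj_on ?f (range rep)" by (intro inj_onI) (metis rangeE rep_eq rep_rep succ_inj)
    then have "?f ` range rep = range rep" using fin by (intro endo_inj_surj) auto
    then have "rep \<^bold>0 \<in> ?f ` range rep" by simp
    then obtain t where "rep \<^bold>0 = ?f (rep t)" by blast
    then show False using succ_neq_0 sym rep_eq by metis
  qed
  \<comment> \<open>\<open>h\<close> numbers the classes bijectively by the natural numbers, so it
    maps terms onto \<open>nat\<close> and identifies exactly the provably equal ones. The function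
    \<open>c\<close> below chooses a term for each number.\<close>
  define h where "h = (\<lambda>t. to_nat_on (range rep) (rep t))"
  have h_eq: "h s = h t \<longleftrightarrow> (s \<^bold>= t) \<in> H" for s t
    by (simp add: h_def rep_eq[symmetric, unfolded eq_def])
  have h_surj: "\<exists>t. h t = n" for n
  proof -
    have "bij_betw (to_nat_on (range rep)) (range rep) UNIV"
      using inf by (intro to_nat_on_infinite) auto
    then have "n \<in> to_nat_on (range rep) ` range rep" by (simp add: bij_betw_def)
    then show ?thesis by (auto simp: h_def)
  qed
  define c where "c = (\<lambda>n. SOME t. h t = n)"
  have hc: "h (c n) = n" for n unfolding c_def using h_surj by (rule someI_ex)
  have inst_shift: "subT (case_nat s Var) (shiftT t) = t" for s t
    by (simp add: shiftT_def subT_subT)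
  have cong: "h (subT (case_nat (c (h s)) Var) u) = h (subT (case_nat s Var) u)" for s u
    unfolding h_eq using ctxt[of "c (h s)" s u] hc[of "h s"] by (simp only: eq_def h_eq)
  have h_add: "h (c (h s) \<^bold>+ c (h t)) = h (s \<^bold>+ t)" for s t
    using cong[of s "Var 0 \<^bold>+ shiftT (c (h t))"] cong[of t "shiftT s \<^bold>+ Var 0"] by (simp add: inst_shift)
  have h_mul: "h (c (h s) \<^bold>\<times> c (h t)) = h (s \<^bold>\<times> t)" for s t
    using cong[of s "Var 0 \<^bold>\<times> shiftT (c (h t))"] cong[of t "shiftT s \<^bold>\<times> Var 0"] by (simp add: inst_shift)
  have congH: "instN (c (h s)) p \<in> H \<longleftrightarrow> instN s p \<in> H" for s p
    using subst[of "c (h s)" s p] subst[of s "c (h s)" p] hc h_eq by (metis eq_def)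
  have h_less: "(c (h s) \<^bold>< c (h t)) \<in> H \<longleftrightarrow> (s \<^bold>< t) \<in> H" for s t
    using congH[of s "Var 0 \<^bold>< shiftT (c (h t))"] congH[of t "shiftT s \<^bold>< Var 0"]
    by (simp add: inst_shift instN_def)
  have h_mem: "(c (h s) \<^bold>\<in> X) \<in> H \<longleftrightarrow> (s \<^bold>\<in> X) \<in> H" for s X
    using congH[of s "Var 0 \<^bold>\<in> X"] by (simp add: instN_def)
  \<comment> \<open>The set sort consists of the set variables themselves: the language has no
    equality between sets, so no quotient is taken.\<close>
  define M_add M_mul M_less M_mem where "M_add = (\<lambda>m n. h (c m \<^bold>+ c n))"
    and "M_mul = (\<lambda>m n. h (c m \<^bold>\<times> c n))" and "M_less = (\<lambda>m n. (c m \<^bold>< c n) \<in> H)"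
    and "M_mem = (\<lambda>m X. (c m \<^bold>\<in> X) \<in> H)"
  have M_h: "M_add (h s) (h t) = h (s \<^bold>+ t)" "M_mul (h s) (h t) = h (s \<^bold>\<times> t)"
    "M_less (h s) (h t) \<longleftrightarrow> (s \<^bold>< t) \<in> H" "M_mem (h s) X \<longleftrightarrow> (s \<^bold>\<in> X) \<in> H" for s t X
    by (simp_all add: M_add_def M_mul_def M_less_def M_mem_def h_add h_mul h_less h_mem)
  interpret M: L2_structure "h \<^bold>0" "h \<^bold>1" M_add M_mul M_less M_mem .
  have evT: "M.evT (\<lambda>n. h (\<sigma> n)) t = h (subT \<sigma> t)" for \<sigma> t
    by (induction t) (auto simp: M_h)
  \<comment> \<open>The truth lemma. It is stated for all substitutions so that in the quantifier
    cases the instantiating term or set variable can be absorbed into the substitution.\<close>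
  have sat: "M.sat (\<lambda>n. h (\<sigma> n)) \<rho> p \<longleftrightarrow> sub \<sigma> \<rho> p \<in> H" for \<sigma> \<rho> p
  proof (induction p arbitrary: \<sigma> \<rho>)
    case (AllN p)
    have "M.sat (\<lambda>n. h (\<sigma> n)) \<rho> (AllN p) \<longleftrightarrow> (\<forall>t. M.sat (case_nat (h t) (\<lambda>n. h (\<sigma> n))) \<rho> p)"
      unfolding M.sat.simps by (metis h_surj)
    moreover have "case_nat (h t) (\<lambda>n. h (\<sigma> n)) = (\<lambda>n. h (case_nat t \<sigma> n))" for t
      by (auto split: nat.split)
    moreover have "sub (case_nat t \<sigma>) \<rho> p = instN t (sub (upN \<sigma>) \<rho> p)" for t
      by (auto simp: instN_def sub_sub intro!: sub_cong split: nat.split)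
    ultimately show ?case by (simp add: H_AllN AllN.IH)
  next
    case (AllS p)
    have "sub \<sigma> (case_nat X \<rho>) p = instS X (sub \<sigma> (upS \<rho>) p)" for X
      by (auto simp: instS_def sub_sub intro!: sub_cong split: nat.split)
    then show ?case by (simp add: H_AllS AllS.IH)
  qed (auto simp: evT h_eq M_h Bot Imp)
  have "M.sat e S q" if "q \<in> T" for e S q
  proof -
    have "M.sat (\<lambda>n. h (Var n)) id q" using sat[of Var id q] that TH by auto
    then show ?thesis using M.bound_cong[OF closed[rule_format, OF that], of e _ S id] by simp
  qed
  then show ?thesis by (rule that)
qed

section \<open>Definability in a model\<close>

lemma subT_shiftT: "subT (upN \<sigma>) (shiftT t) = shiftT (subT \<sigma> t)"
  by (simp add: shiftT_def subT_subT)

lemma Delta00_sub: "p \<in> Delta00 \<Longrightarrow> sub \<sigma> \<rho> p \<in> Delta00"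
proof (induction arbitrary: \<sigma> \<rho> rule: Delta00.induct)
  case (6 p t)
  have "sub \<sigma> \<rho> (AllB t p) = AllB (subT \<sigma> t) (sub (upN \<sigma>) \<rho> p)"
    by (simp add: AllB_def subT_shiftT)
  then show ?case using 6 by (simp add: Delta00.intros)
next
  case (7 p t)
  have "sub \<sigma> \<rho> (ExB t p) = ExB (subT \<sigma> t) (sub (upN \<sigma>) \<rho> p)"
    by (simp add: ExB_def ExN_def And_def subT_shiftT)
  then show ?case using 7 by (simp add: Delta00.intros)
qed (auto intro: Delta00.intros)

locale BSigma02_model =
  L2_structure zero one add mul less mem
  for zero one :: "'a::countable" and add mul less and mem :: "'a \<Rightarrow> 'b::countable \<Rightarrow> bool" +
  assumes sat_basic: "p \<in> basic_axioms \<Longrightarrow> sat e S p"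
    and sat_ind: "p \<in> Sigma01 \<Longrightarrow> sat e S (ind p)"
    and sat_comprehension: "p \<in> Sigma01 \<Longrightarrow> q \<in> Pi01 \<Longrightarrow> sat e S (comprehension p q)"
    and sat_bounding: "p \<in> Sigma02 \<Longrightarrow> sat e S (bounding p)"
begin

notation add (infixl \<open>\<oplus>\<close> 65)
notation mul (infixl \<open>\<otimes>\<close> 70)
notation less (infix \<open>\<prec>\<close> 50)

text \<open>Both sorts of the model are countable, so a single assignment can name all its elements:
  the odd number variables and the set variables are constants, and only the even number
  variables are free.  Definability below is therefore definability with parameters.\<close>

definition mix :: "(nat \<Rightarrow> 'a) \<Rightarrow> nat \<Rightarrow> 'a" where
  "mix e i = (if even i then e (i div 2) else from_nat (i div 2))"

definition term_def :: "((nat \<Rightarrow> 'a) \<Rightarrow> 'a) \<Rightarrow> bool" where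
  "term_def f \<longleftrightarrow> (\<exists>t. \<forall>e. evT (mix e) t = f e)"

definition D0 :: "((nat \<Rightarrow> 'a) \<Rightarrow> bool) \<Rightarrow> bool" where
  "D0 P \<longleftrightarrow> (\<exists>p\<in>Delta00. \<forall>e. sat (mix e) from_nat p \<longleftrightarrow> P e)"

section \<open>Closure properties of bounded definability\<close>

lemma term_var: "term_def (\<lambda>e. e n)"
  unfolding term_def_def by (rule exI[of _ "Var (2 * n)"]) (simp add: mix_def)

lemma term_const: "term_def (\<lambda>e. c)"
  unfolding term_def_def by (rule exI[of _ "Var (2 * to_nat c + 1)"]) (simp add: mix_def)

lemma term_add: "term_def f \<Longrightarrow> term_def g \<Longrightarrow> term_def (\<lambda>e. f e \<oplus> g e)"
  unfolding term_def_def by (metis evT.simps(4))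

lemma term_mul: "term_def f \<Longrightarrow> term_def g \<Longrightarrow> term_def (\<lambda>e. f e \<otimes> g e)"
  unfolding term_def_def by (metis evT.simps(5))

lemma D0_eq: "term_def f \<Longrightarrow> term_def g \<Longrightarrow> D0 (\<lambda>e. f e = g e)"
  unfolding term_def_def D0_def by (metis Delta00.intros(1) sat.simps(1))

lemma D0_less: "term_def f \<Longrightarrow> term_def g \<Longrightarrow> D0 (\<lambda>e. f e \<prec> g e)"
  unfolding term_def_def D0_def by (metis Delta00.intros(2) sat.simps(2))

lemma D0_mem: "term_def f \<Longrightarrow> D0 (\<lambda>e. mem (f e) X)"
  unfolding term_def_def D0_def by (metis Delta00.intros(3) sat.simps(3) from_nat_to_nat)

lemma D0_imp: "D0 P \<Longrightarrow> D0 Q \<Longrightarrow> D0 (\<lambda>e. P e \<longrightarrow> Q e)"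
  unfolding D0_def by (metis Delta00.intros(5) sat.simps(5))

lemma D0_False: "D0 (\<lambda>e. False)"
  unfolding D0_def by (metis Delta00.intros(4) sat.simps(4))

lemma D0_not: "D0 P \<Longrightarrow> D0 (\<lambda>e. \<not> P e)"
  using D0_imp[OF _ D0_False] by simp

lemma D0_const: "D0 (\<lambda>e. A)"
  using D0_False D0_not[OF D0_False] by (cases A) auto

lemma D0_or: "D0 P \<Longrightarrow> D0 Q \<Longrightarrow> D0 (\<lambda>e. P e \<or> Q e)"
  using D0_imp[OF D0_not, of P Q] by (simp add: disj_imp)

lemma D0_and: "D0 P \<Longrightarrow> D0 Q \<Longrightarrow> D0 (\<lambda>e. P e \<and> Q e)"
  using D0_not[OF D0_imp[OF _ D0_not, of P Q]] by simp

lemma D0_iff: "D0 P \<Longrightarrow> D0 Q \<Longrightarrow> D0 (\<lambda>e. P e \<longleftrightarrow> Q e)"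
  using D0_and[OF D0_imp D0_imp, of P Q Q P] by (simp add: iff_conv_conj_imp)

text \<open>The axioms quantify the front variables of an assignment, whereas \<open>mix\<close>
  interleaves free variables with constants. Renaming brings the first \<open>k\<close> free
  variables to the front and leaves a mixed assignment behind them.\<close>

lemma D0_prefix:
  assumes "D0 Q"
  shows "\<exists>p\<in>Delta00. \<forall>e. sat (\<lambda>i. if i < k then e i else mix (\<lambda>j. e (j + k)) (i - k)) from_nat p \<longleftrightarrow> Q e"
proof -
  obtain q where q: "q \<in> Delta00" "\<And>e. sat (mix e) from_nat q \<longleftrightarrow> Q e"
    using assms by (auto simp: D0_def)
  \<comment> \<open>Free variable \<open>j\<close>, which is \<open>Var (2 * j)\<close>, goes to
    \<open>j\<close> if \<open>j < k\<close> and otherwise to \<open>2 * j - k\<close>, which is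
    place \<open>2 * (j - k)\<close> behind the prefix. Constants move up by
    \<open>k\<close>.\<close>
  define \<sigma> where "\<sigma> = (\<lambda>i. Var (if even i then if i div 2 < k then i div 2 else i - k else i + k))"
  have "(\<lambda>n. evT (\<lambda>i. if i < k then e i else mix (\<lambda>j. e (j + k)) (i - k)) (\<sigma> n)) = mix e" for e
  proof
    fix n
    show "evT (\<lambda>i. if i < k then e i else mix (\<lambda>j. e (j + k)) (i - k)) (\<sigma> n) = mix e n"
    proof (cases "even n")
      case True
      then obtain b where n: "n = 2 * b" by blast
      have "2 * b - k - k = 2 * (b - k)" by simp
      then show ?thesis by (auto simp: \<sigma>_def mix_def n simp del: diff_diff_left)
    qed (simp add: \<sigma>_def mix_def)
  qed
  then show ?thesis
    using q by (intro bexI[of _ "sub \<sigma> id q"]) (auto simp: sat_sub Delta00_sub)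
qed

lemma env1: "(\<lambda>i. if i < 1 then e i else mix (\<lambda>j. e (j + 1)) (i - 1)) = case_nat (e 0) (mix (\<lambda>i. e (Suc i)))"
  by (auto split: nat.split)

text \<open>The bound variable is passed as \<open>e 0\<close> and the old environment as the tail,
  a semantic counterpart of de Bruijn binding. In this form higher-order resolution with
  \<open>D0_intros\<close> can take a bounded formula apart.\<close>

lemma D0_All:
  assumes "term_def f" "D0 (\<lambda>e. Q (e 0) (\<lambda>i. e (Suc i)))"
  shows "D0 (\<lambda>e. \<forall>x. x \<prec> f e \<longrightarrow> Q x e)"
proof -
  obtain t where t: "\<And>e. evT (mix e) t = f e" using assms(1) by (auto simp: term_def_def)
  obtain p where p: "p \<in> Delta00" "\<And>e. sat (case_nat (e 0) (mix (\<lambda>i. e (Suc i)))) from_nat p \<longleftrightarrow> Q (e 0) (\<lambda>i. e (Suc i))"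
    using D0_prefix[OF assms(2), of 1] unfolding env1 by auto
  have "sat (case_nat x (mix e)) from_nat p \<longleftrightarrow> Q x e" for x e
    using p(2)[of "case_nat x e"] by simp
  then show ?thesis
    unfolding D0_def using p(1) by (intro bexI[of _ "AllB t p"]) (auto simp: t intro: Delta00.intros)
qed

lemma D0_Ex:
  assumes "term_def f" "D0 (\<lambda>e. Q (e 0) (\<lambda>i. e (Suc i)))"
  shows "D0 (\<lambda>e. \<exists>x. x \<prec> f e \<and> Q x e)"
  using D0_not[OF D0_All[OF assms(1) D0_not[OF assms(2)]]] by simp

lemmas D0_intros = term_var term_const term_add term_mul D0_eq D0_less D0_mem D0_const D0_not D0_imp
  D0_and D0_or D0_iff D0_All D0_Ex

lemma D0_subst:
  assumes "D0 P" "\<And>i. term_def (\<lambda>e. g e i)"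
  shows "D0 (\<lambda>e. P (g e))"
proof -
  obtain p where p: "p \<in> Delta00" "\<And>e. sat (mix e) from_nat p \<longleftrightarrow> P e"
    using assms(1) by (auto simp: D0_def)
  have "\<forall>i. \<exists>t. \<forall>e. evT (mix e) t = g e i" using assms(2) by (simp add: term_def_def)
  then obtain t where t: "\<And>i e. evT (mix e) (t i) = g e i" by metis
  have "(\<lambda>n. evT (mix e) (if even n then t (n div 2) else Var n)) = mix (g e)" for e
    by (auto simp: mix_def t)
  then show ?thesis
    unfolding D0_def using p
    by (intro bexI[of _ "sub (\<lambda>n. if even n then t (n div 2) else Var n) id p"])
      (auto simp: sat_sub Delta00_sub)
qed

lemma D0_rename: "D0 P \<Longrightarrow> D0 (\<lambda>e. P (\<lambda>i. e (\<pi> i)))"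
  by (rule D0_subst[OF _ term_var])

lemma D0_subst2:
  assumes "D0 (\<lambda>e. R (e 0) (e 1))" "term_def f" "term_def g"
  shows "D0 (\<lambda>e. R (f e) (g e))"
proof -
  have "term_def (\<lambda>e. case_nat (f e) (\<lambda>_. g e) i)" for i
    using assms(2,3) by (cases i) simp_all
  then show ?thesis using D0_subst[OF assms(1), of "\<lambda>e. case_nat (f e) (\<lambda>_. g e)"] by simp
qed

lemma D0_subst3:
  assumes "D0 (\<lambda>e. R (e 0) (e 1) (e 2))" "term_def f" "term_def g" "term_def h"
  shows "D0 (\<lambda>e. R (f e) (g e) (h e))"
proof -
  have "term_def (\<lambda>e. case_nat (f e) (case_nat (g e) (\<lambda>_. h e)) i)" for i
    using assms(2-4) by (cases i; cases "i - 1") simp_all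
  then show ?thesis
    using D0_subst[OF assms(1), of "\<lambda>e. case_nat (f e) (case_nat (g e) (\<lambda>_. h e))"]
    by (simp add: numeral_2_eq_2)
qed

section \<open>Semantic forms of the axiom schemes\<close>

lemma D0_prefix2:
  assumes "D0 (\<lambda>e. Q (e 0) (e 1))"
  shows "\<exists>p\<in>Delta00. \<forall>x y e. sat (case_nat y (case_nat x (mix e))) from_nat p \<longleftrightarrow> Q y x"
proof -
  obtain p where p: "p \<in> Delta00" "\<And>e. sat (\<lambda>i. if i < 2 then e i else mix (\<lambda>j. e (j + 2)) (i - 2)) from_nat p \<longleftrightarrow> Q (e 0) (e 1)"
    using D0_prefix[OF assms, of 2] by auto
  have "sat (case_nat y (case_nat x (mix e))) from_nat p \<longleftrightarrow> Q y x" for x y e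
  proof -
    have "(\<lambda>i. if i < 2 then case_nat y (case_nat x e) i else mix (\<lambda>j. case_nat y (case_nat x e) (j + 2)) (i - 2)) =
      case_nat y (case_nat x (mix e))"
      by (auto split: nat.split simp: numeral_2_eq_2)
    then show ?thesis using p(2)[of "case_nat y (case_nat x e)"] by simp
  qed
  then show ?thesis using p(1) by (intro bexI[of _ p]) simp_all
qed

lemma Sigma1_induct:
  assumes D0: "D0 (\<lambda>e. Q (e 0) (e 1))" and base: "\<exists>y. Q y zero"
    and step: "\<And>x. \<exists>y. Q y x \<Longrightarrow> \<exists>y. Q y (x \<oplus> one)"
  shows "\<exists>y. Q y x"
proof -
  obtain q where q: "q \<in> Delta00" "\<forall>x y e. sat (case_nat y (case_nat x (mix e))) from_nat q \<longleftrightarrow> Q y x"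
    using D0_prefix2[OF D0] by (elim bexE) (rule that)
  obtain p where p: "p \<in> Sigma01" "\<And>x e. sat (case_nat x (mix e)) from_nat p \<longleftrightarrow> (\<exists>y. Q y x)"
    using q by (intro that[of "ExN q"]) (auto simp: Sigma01_def)
  let ?e = "mix (\<lambda>_. zero)"
  have "(\<lambda>n. evT ?e (case_nat \<^bold>0 Var n)) = case_nat zero ?e"
    "(\<lambda>n. evT (case_nat x ?e) (case_nat (Var 0 \<^bold>+ \<^bold>1) (\<lambda>i. Var (Suc i)) n)) = case_nat (x \<oplus> one) ?e" for x
    by (auto split: nat.split)
  then show ?thesis
    using sat_ind[OF p(1), of ?e from_nat] base step
    by (auto simp: ind_def instN_def sat_sub p(2))
qed

text \<open>An instance with a vacuous existential witness; renaming by \<open>Suc\<close> moves the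
  induction variable out of the place of the witness.\<close>

lemma D0_induct [case_names definable zero Suc]:
  assumes D0: "D0 (\<lambda>e. P (e 0))" and "P zero" and "\<And>x. P x \<Longrightarrow> P (x \<oplus> one)"
  shows "P x"
  using Sigma1_induct[of "\<lambda>_. P" x] D0_rename[OF D0, of Suc] assms(2,3) by simp

lemma Delta1_comprehension:
  assumes Q: "D0 (\<lambda>e. Q (e 0) (e 1))" and R: "D0 (\<lambda>e. R (e 0) (e 1))"
    and iff: "\<And>x. (\<exists>y. Q y x) \<longleftrightarrow> (\<forall>y. R y x)"
  shows "\<exists>X. \<forall>x. mem x X \<longleftrightarrow> (\<exists>y. Q y x)"
proof -
  obtain p where p: "p \<in> Delta00" "\<forall>x y e. sat (case_nat y (case_nat x (mix e))) from_nat p \<longleftrightarrow> Q y x"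
    using D0_prefix2[OF Q] by (elim bexE) (rule that)
  obtain q where q: "q \<in> Delta00" "\<forall>x y e. sat (case_nat y (case_nat x (mix e))) from_nat q \<longleftrightarrow> R y x"
    using D0_prefix2[OF R] by (elim bexE) (rule that)
  have "ExN p \<in> Sigma01" "AllN q \<in> Pi01" using p(1) q(1) by (auto simp: Sigma01_def Pi01_def)
  from sat_comprehension[OF this, of "mix (\<lambda>_. zero)" from_nat] show ?thesis
    using iff by (auto simp: comprehension_def shiftS_def sat_sub p(2) q(2))
qed

lemma D0_comprehension:
  assumes "D0 (\<lambda>e. P (e 0))"
  shows "\<exists>X. \<forall>x. mem x X \<longleftrightarrow> P x"
  using Delta1_comprehension[of "\<lambda>_. P" "\<lambda>_. P"] D0_rename[OF assms, of Suc] by simp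

text \<open>A universal matrix becomes a formula of \<open>Sigma02\<close> by prefixing a vacuous
  existential quantifier, so the bounding axioms apply to it.\<close>

lemma Pi1_bounding:
  assumes D0: "D0 (\<lambda>e. Q (e 0) (e 1) (e 2))" and ex: "\<And>x. x \<prec> a \<Longrightarrow> \<exists>y. \<forall>s. Q s y x"
  shows "\<exists>b. \<forall>x. x \<prec> a \<longrightarrow> (\<exists>y. y \<prec> b \<and> (\<forall>s. Q s y x))"
proof -
  \<comment> \<open>Place 1 is left free for the vacuous variable \<open>z\<close>, which is bound
    between \<open>s\<close> and \<open>y\<close>.\<close>
  have "D0 (\<lambda>e. Q (e 0) (e 2) (e 3))"
    using D0_rename[OF D0, of "\<lambda>i. if i = 0 then 0 else i + 1"] by (simp add: eval_nat_numeral)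
  from D0_prefix[OF this, of 4] obtain p where p: "p \<in> Delta00"
    "\<And>e. sat (\<lambda>i. if i < 4 then e i else mix (\<lambda>j. e (j + 4)) (i - 4)) from_nat p \<longleftrightarrow> Q (e 0) (e 2) (e 3)"
    by auto
  have p': "sat (case_nat s (case_nat z (case_nat y (case_nat x (mix e))))) from_nat p \<longleftrightarrow> Q s y x" for s z y x e
  proof -
    let ?e = "case_nat s (case_nat z (case_nat y (case_nat x e)))"
    have "(\<lambda>i. if i < 4 then ?e i else mix (\<lambda>j. ?e (j + 4)) (i - 4)) =
      case_nat s (case_nat z (case_nat y (case_nat x (mix e))))"
      by (auto split: nat.split simp: eval_nat_numeral)
    then show ?thesis using p(2)[of ?e] by (simp add: eval_nat_numeral)
  qed
  obtain P where P: "P \<in> Sigma02"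
    and P_sat: "\<And>x y e. sat (case_nat y (case_nat x (mix e))) from_nat P \<longleftrightarrow> (\<forall>s. Q s y x)"
    using p(1) by (intro that[of "ExN (AllN p)"]) (auto simp: Sigma02_def p')
  have env: "(\<lambda>n. evT (case_nat y (case_nat x (case_nat b e))) (case_nat (Var 0) (case_nat (Var (Suc 0)) (\<lambda>i. Var (i + 3))) n)) =
      case_nat y (case_nat x e)" for y x b e
    by (auto split: nat.split simp: eval_nat_numeral)
  let ?e = "mix (\<lambda>_. a)"
  have a: "?e 0 = a" by (simp add: mix_def)
  show ?thesis
    using sat_bounding[OF P, of ?e from_nat] ex
    by (auto simp: bounding_def sat_sub env P_sat a)
qed

end

section \<open>Arithmetic in a model\<close>

context BSigma02_model
begin

lemma basic:
  "n \<oplus> one \<noteq> zero" "m \<oplus> one = n \<oplus> one \<longleftrightarrow> m = n"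
  "m \<oplus> zero = m" "m \<oplus> (n \<oplus> one) = (m \<oplus> n) \<oplus> one"
  "m \<otimes> zero = zero" "m \<otimes> (n \<oplus> one) = (m \<otimes> n) \<oplus> m"
  "\<not> m \<prec> zero" "m \<prec> n \<oplus> one \<longleftrightarrow> m \<prec> n \<or> m = n"
proof -
  let ?e = "case_nat m (case_nat n undefined)"
  have "\<forall>p\<in>basic_axioms. sat ?e undefined p"
    using sat_basic by blast
  then have *: "n \<oplus> one \<noteq> zero \<and> (m \<oplus> one = n \<oplus> one \<longrightarrow> m = n) \<and>
    m \<oplus> zero = m \<and> m \<oplus> (n \<oplus> one) = (m \<oplus> n) \<oplus> one \<and>
    m \<otimes> zero = zero \<and> m \<otimes> (n \<oplus> one) = (m \<otimes> n) \<oplus> m \<and>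
    \<not> m \<prec> zero \<and> (m \<prec> n \<oplus> one \<longleftrightarrow> m \<prec> n \<or> m = n)"
    unfolding basic_axioms_def Let_def by (simp only: ball_simps sat_simps sat.simps evT.simps) simp
  from * show "n \<oplus> one \<noteq> zero" by (elim conjE)
  from * show "m \<oplus> one = n \<oplus> one \<longleftrightarrow> m = n" by (elim conjE) (rule iffI, erule mp, assumption, simp)
  from * show "m \<oplus> zero = m" by (elim conjE)
  from * show "m \<oplus> (n \<oplus> one) = (m \<oplus> n) \<oplus> one" by (elim conjE)
  from * show "m \<otimes> zero = zero" by (elim conjE)
  from * show "m \<otimes> (n \<oplus> one) = (m \<otimes> n) \<oplus> m" by (elim conjE)
  from * show "\<not> m \<prec> zero" by (elim conjE)
  from * show "m \<prec> n \<oplus> one \<longleftrightarrow> m \<prec> n \<or> m = n" by (elim conjE)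
qed

lemma add_zero_left: "zero \<oplus> n = n"
proof (induction n rule: D0_induct)
  case definable
  show ?case by (intro D0_intros)
qed (simp_all add: basic)

text \<open>As in the other identities, the variables apart from the induction variable are
  constants for \<open>D0\<close>, so induction on a formula in one variable suffices.\<close>

lemma add_Suc_left: "(m \<oplus> one) \<oplus> n = (m \<oplus> n) \<oplus> one"
proof (induction n rule: D0_induct)
  case definable
  show ?case by (intro D0_intros)
qed (simp_all add: basic)

lemma add_commute: "m \<oplus> n = n \<oplus> m"
proof (induction n rule: D0_induct)
  case definable
  show ?case by (intro D0_intros)
qed (simp_all add: basic add_zero_left add_Suc_left)

lemma add_assoc: "a \<oplus> b \<oplus> c = a \<oplus> (b \<oplus> c)"
proof (induction c rule: D0_induct)
  case definable
  show ?case by (intro D0_intros)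
qed (simp_all add: basic)

lemma add_left_commute: "a \<oplus> (b \<oplus> c) = b \<oplus> (a \<oplus> c)"
  by (metis add_assoc add_commute)

lemma add_cancel: "a \<oplus> c = b \<oplus> c \<Longrightarrow> a = b"
proof (induction c rule: D0_induct)
  case definable
  show ?case by (intro D0_intros)
qed (simp_all add: basic)

lemma add_cancel_left: "c \<oplus> a = c \<oplus> b \<Longrightarrow> a = b"
  using add_cancel add_commute by metis

lemma distrib: "a \<otimes> (b \<oplus> c) = (a \<otimes> b) \<oplus> (a \<otimes> c)"
proof (induction c rule: D0_induct)
  case definable
  show ?case by (intro D0_intros)
next
  case (Suc c)
  then show ?case by (metis basic(4,6) add_assoc)
qed (simp add: basic)

lemma mul_zero_left: "zero \<otimes> n = zero"
proof (induction n rule: D0_induct)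
  case definable
  show ?case by (intro D0_intros)
qed (simp_all add: basic)

lemma mul_Suc_left: "(m \<oplus> one) \<otimes> n = (m \<otimes> n) \<oplus> n"
proof (induction n rule: D0_induct)
  case definable
  show ?case by (intro D0_intros)
next
  case (Suc n)
  then show ?case
    by (simp only: basic(6)) (simp only: add_assoc add_commute add_left_commute)
qed (simp_all add: basic)

lemma mul_commute: "m \<otimes> n = n \<otimes> m"
proof (induction n rule: D0_induct)
  case definable
  show ?case by (intro D0_intros)
qed (simp_all add: basic mul_zero_left mul_Suc_left)

lemma mul_assoc: "a \<otimes> b \<otimes> c = a \<otimes> (b \<otimes> c)"
proof (induction c rule: D0_induct)
  case definable
  show ?case by (intro D0_intros)
next
  case (Suc c)
  then show ?case by (metis basic(6) distrib)
qed (simp add: basic)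

lemma mul_one: "one \<otimes> a = a"
  by (metis add_zero_left mul_Suc_left mul_zero_left)

lemma cases_Suc: obtains "x = zero" | y where "x = y \<oplus> one"
proof -
  have "\<exists>y. x = zero \<or> x = y \<oplus> one"
    by (rule Sigma1_induct) (intro D0_intros, auto)
  then show ?thesis using that by blast
qed

lemma less_add: "m \<prec> m \<oplus> (k \<oplus> one)"
proof (induction k rule: D0_induct)
  case definable
  show ?case by (intro D0_intros)
qed (simp_all add: basic)

text \<open>The axioms describe the order only through zero and successor; this ties it to addition.
  The witness \<open>k\<close> is moved in front of the implication to make the induction formula
  existential with a bounded matrix.\<close>

lemma less_iff: "m \<prec> n \<longleftrightarrow> (\<exists>k. m \<oplus> (k \<oplus> one) = n)"
proof
  have "\<exists>k. m \<prec> n \<longrightarrow> m \<oplus> (k \<oplus> one) = n"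
  proof (rule Sigma1_induct)
    show "D0 (\<lambda>e. m \<prec> e 1 \<longrightarrow> m \<oplus> (e 0 \<oplus> one) = e 1)" by (intro D0_intros)
  next
    fix x assume "\<exists>k. m \<prec> x \<longrightarrow> m \<oplus> (k \<oplus> one) = x"
    then show "\<exists>k. m \<prec> x \<oplus> one \<longrightarrow> m \<oplus> (k \<oplus> one) = x \<oplus> one"
      by (metis add_zero_left basic(4,8))
  qed (simp add: basic)
  then show "m \<prec> n \<Longrightarrow> \<exists>k. m \<oplus> (k \<oplus> one) = n" by blast
qed (use less_add in blast)

lemma less_irrefl: "\<not> m \<prec> m"
proof
  assume "m \<prec> m"
  then obtain k where "m \<oplus> (k \<oplus> one) = m \<oplus> zero" by (auto simp: less_iff basic(3))
  then show False using add_cancel_left basic(1) by blast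
qed

lemma less_trans: "a \<prec> b \<Longrightarrow> b \<prec> c \<Longrightarrow> a \<prec> c"
  unfolding less_iff by (metis add_assoc)

lemma less_total: "m \<prec> n \<or> m = n \<or> n \<prec> m"
proof (induction n rule: D0_induct)
  case definable
  show ?case by (intro D0_intros)
next
  case zero
  then show ?case by (cases m rule: cases_Suc) (auto intro: less_add[of zero, unfolded add_zero_left])
next
  case (Suc n)
  have "m = n \<oplus> one \<or> n \<oplus> one \<prec> m" if nm: "n \<prec> m"
  proof -
    obtain k where "n \<oplus> (k \<oplus> one) = m" using nm by (auto simp: less_iff)
    then show ?thesis
    proof (cases k rule: cases_Suc)
      case 1
      then show ?thesis using \<open>n \<oplus> (k \<oplus> one) = m\<close> by (simp add: add_zero_left)
    next
      case (2 y)
      then have "(n \<oplus> one) \<oplus> (y \<oplus> one) = m"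
        using \<open>n \<oplus> (k \<oplus> one) = m\<close> by (simp add: add_assoc add_commute add_left_commute)
      then show ?thesis unfolding less_iff by blast
    qed
  qed
  then show ?case using Suc by (auto simp: basic(8))
qed

text \<open>Truncated subtraction, an operation demanded by the class
  \<open>linordered_semidom\<close>. It is chosen in HOL and enters no formula of the model.\<close>

definition minus :: "'a \<Rightarrow> 'a \<Rightarrow> 'a" where
  "minus a b = (if b \<prec> a then SOME k. b \<oplus> k = a else zero)"

definition le (infix \<open>\<preceq>\<close> 50) where
  "a \<preceq> b \<longleftrightarrow> a \<prec> b \<or> a = b"

lemma minus_add: "minus (a \<oplus> b) a = b"
proof (cases b rule: cases_Suc)
  case 1
  then show ?thesis by (simp add: minus_def basic less_irrefl)
next
  case 2
  then have "a \<prec> a \<oplus> b" using less_add by blast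
  then have "a \<oplus> minus (a \<oplus> b) a = a \<oplus> b" unfolding minus_def by (auto intro: someI)
  then show ?thesis by (rule add_cancel_left)
qed

lemma minus_eq_zero: "\<not> b \<prec> a \<Longrightarrow> minus a b = zero"
  by (simp add: minus_def)

lemma le_iff: "a \<preceq> b \<longleftrightarrow> (\<exists>k. a \<oplus> k = b)"
  unfolding le_def by (metis basic(3) cases_Suc less_iff)

lemma minus_minus: "minus (minus a b) c = minus a (b \<oplus> c)"
proof (cases "b \<oplus> c \<prec> a")
  case True
  then obtain k where "a = b \<oplus> (c \<oplus> k)" by (auto simp: less_iff add_assoc)
  then show ?thesis using minus_add[of "b \<oplus> c" k] by (simp add: minus_add add_assoc)
next
  case False
  have "\<not> c \<prec> minus a b"
  proof
    assume c: "c \<prec> minus a b"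
    then have "b \<prec> a" using minus_eq_zero basic(7) by metis
    then obtain k where k: "a = b \<oplus> k" by (auto simp: less_iff)
    then obtain j where "k = c \<oplus> (j \<oplus> one)" using c by (auto simp: minus_add less_iff)
    then have "b \<oplus> c \<prec> a" using k less_add[of "b \<oplus> c" j] by (simp add: add_assoc)
    then show False using False by simp
  qed
  then show ?thesis using False by (simp add: minus_eq_zero)
qed

lemma mult_less:
  assumes "a \<prec> b" "zero \<prec> c"
  shows "c \<otimes> a \<prec> c \<otimes> b"
proof -
  obtain k d where "b = a \<oplus> (k \<oplus> one)" "c = d \<oplus> one"
    using assms by (metis less_iff add_zero_left)
  then have "c \<otimes> b = (c \<otimes> a) \<oplus> (((c \<otimes> k) \<oplus> d) \<oplus> one)"
    using distrib[of c a "k \<oplus> one"] distrib[of c k one] by (metis add_assoc basic(6) mul_commute mul_one)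
  then show ?thesis using less_add by simp
qed

lemma mult_minus: "a \<otimes> minus b c = minus (a \<otimes> b) (a \<otimes> c)"
proof (cases "c \<prec> b")
  case True
  then obtain k where "b = c \<oplus> k" by (auto simp: less_iff)
  then show ?thesis by (simp add: minus_add distrib)
next
  case False
  then obtain k where k: "c = b \<oplus> k" using le_iff less_total unfolding le_def by metis
  have "\<not> a \<otimes> c \<prec> a \<otimes> b"
  proof
    assume "a \<otimes> c \<prec> a \<otimes> b"
    then obtain m where "(a \<otimes> b) \<oplus> (((a \<otimes> k) \<oplus> m) \<oplus> one) = a \<otimes> b"
      by (auto simp: less_iff k distrib add_assoc)
    then show False using less_add[of "a \<otimes> b" "(a \<otimes> k) \<oplus> m"] less_irrefl[of "a \<otimes> b"] by simp
  qed
  then show ?thesis using False by (simp add: minus_eq_zero basic)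
qed

lemma mult_nonzero: "a \<noteq> zero \<Longrightarrow> b \<noteq> zero \<Longrightarrow> a \<otimes> b \<noteq> zero"
proof -
  assume "a \<noteq> zero" "b \<noteq> zero"
  then obtain x y where "a = x \<oplus> one" "b = y \<oplus> one" by (metis cases_Suc)
  then have "a \<otimes> b = ((a \<otimes> y) \<oplus> x) \<oplus> one" using basic(4)[of "a \<otimes> y" x] basic(6)[of a y] by simp
  then show ?thesis using basic(1) by simp
qed

text \<open>Makes the library facts on ordered semirings and divisibility available in the model;
  the coding of sets relies on \<open>ar.dvd\<close>.\<close>

sublocale ar: linordered_semidom where plus = add and times = mul and zero = zero and one = one
  and less = less and less_eq = le and minus = minus
proof unfold_locales
  show "x \<prec> y \<longleftrightarrow> x \<preceq> y \<and> \<not> y \<preceq> x" for x y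
    unfolding le_def using less_irrefl[of x] less_trans[of x y x] by blast
  show "x \<preceq> y \<Longrightarrow> y \<preceq> x \<Longrightarrow> x = y" for x y
    unfolding le_def using less_irrefl[of x] less_trans[of x y x] by blast
  show "x \<preceq> y \<or> y \<preceq> x" for x y
    unfolding le_def using less_total[of x y] by blast
  show "a \<preceq> b \<Longrightarrow> c \<oplus> a \<preceq> c \<oplus> b" for a b c
    unfolding le_iff using add_assoc by blast
  show "x \<preceq> x" for x by (simp add: le_def)
  show "x \<preceq> y \<Longrightarrow> y \<preceq> z \<Longrightarrow> x \<preceq> z" for x y z
    unfolding le_def using less_trans by blast
  show "(a \<oplus> b) \<otimes> c = (a \<otimes> c) \<oplus> (b \<otimes> c)" for a b c
    using distrib[of c a b] by (simp only: mul_commute)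
  show "zero \<prec> one" using less_add[of zero zero] by (simp add: add_zero_left)
  show "zero \<noteq> one" using basic(1)[of zero] by (simp add: add_zero_left)
  show "minus a b \<oplus> b = a" if b: "b \<preceq> a" for a b
  proof -
    obtain k where "a = b \<oplus> k" using b unfolding le_iff by blast
    then show ?thesis by (simp only: minus_add add_commute)
  qed
  show "c \<otimes> a \<prec> c \<otimes> b" if "a \<prec> b" "zero \<prec> c" for a b c
    using that by (rule mult_less)
  show "a \<otimes> b \<noteq> zero" if "a \<noteq> zero" "b \<noteq> zero" for a b
    using that by (rule mult_nonzero)
qed (fact add_assoc add_commute minus_add minus_minus add_zero_left mul_assoc mul_commute mul_zero_left
  basic(5) mul_one mult_minus distrib)+

end

section \<open>Coding of bounded sets and recursion\<close>

context BSigma02_model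
begin

lemma less_Suc: "x \<prec> y \<oplus> one \<longleftrightarrow> x \<preceq> y"
  by (simp add: basic(8) le_def)

lemma Suc_le: "x \<prec> y \<Longrightarrow> x \<oplus> one \<preceq> y"
  using less_Suc[of y x] ar.not_le by blast

lemma zero_le [simp]: "zero \<preceq> x"
  by (simp add: le_iff add_zero_left)

lemma pos_iff: "zero \<prec> x \<longleftrightarrow> x \<noteq> zero"
  using basic(7) less_total less_irrefl by metis

lemma D0_le: "term_def f \<Longrightarrow> term_def g \<Longrightarrow> D0 (\<lambda>e. f e \<preceq> g e)"
  unfolding le_def by (intro D0_intros)

definition pr :: "'a \<Rightarrow> 'a \<Rightarrow> 'a" where
  "pr i j = ((i \<oplus> j) \<otimes> (i \<oplus> j)) \<oplus> i"

lemma term_pr: "term_def f \<Longrightarrow> term_def g \<Longrightarrow> term_def (\<lambda>e. pr (f e) (g e))"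
  unfolding pr_def by (intro D0_intros)

lemma evT_pair [simp]: "evT e (pair s t) = pr (evT e s) (evT e t)"
  by (simp add: pair_def pr_def)

text \<open>The square dominates: \<open>pr i j\<close> lies below the square of the successor of
  \<open>i \<oplus> j\<close>, which is at most the square of \<open>k \<oplus> l\<close>.
  Injectivity of \<open>pr\<close> follows by comparing the sums.\<close>

lemma pr_less:
  assumes "i \<oplus> j \<prec> k \<oplus> l"
  shows "pr i j \<prec> pr k l"
proof -
  let ?a = "i \<oplus> j" and ?b = "k \<oplus> l"
  have "pr i j \<prec> (?a \<oplus> one) \<otimes> (?a \<oplus> one)"
  proof -
    have "(?a \<oplus> one) \<otimes> (?a \<oplus> one) = pr i j \<oplus> ((j \<oplus> ?a) \<oplus> one)"
      unfolding pr_def by (simp add: algebra_simps)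
    then show ?thesis using less_add by simp
  qed
  also have "(?a \<oplus> one) \<otimes> (?a \<oplus> one) \<preceq> ?b \<otimes> ?b"
    using Suc_le[OF assms] by (intro ar.mult_mono) auto
  also have "?b \<otimes> ?b \<preceq> pr k l" by (simp add: pr_def)
  finally show ?thesis .
qed

lemma pr_inject [simp]: "pr i j = pr k l \<longleftrightarrow> i = k \<and> j = l"
proof
  assume eq: "pr i j = pr k l"
  then have "i \<oplus> j = k \<oplus> l" using pr_less[of i j k l] pr_less[of k l i j] ar.less_linear by fastforce
  then show "i = k \<and> j = l" using eq by (auto simp: pr_def)
qed auto

lemma pr_ge: "i \<preceq> pr i j" "j \<preceq> pr i j"
proof -
  show "i \<preceq> pr i j" by (simp add: pr_def)
  have "x \<preceq> x \<otimes> x" for x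
    by (cases "x = zero") (use Suc_le[of zero x] ar.mult_left_mono[of one x x] in \<open>auto simp: pos_iff add_zero_left\<close>)
  then have "i \<oplus> j \<preceq> (i \<oplus> j) \<otimes> (i \<oplus> j)" .
  also have "\<dots> \<preceq> pr i j" by (simp add: pr_def)
  finally have "i \<oplus> j \<preceq> pr i j" .
  moreover have "j \<preceq> i \<oplus> j" by simp
  ultimately show "j \<preceq> pr i j" by (rule ar.order_trans[rotated])
qed

text \<open>\<open>c\<close> and \<open>d\<close> code the set of all \<open>r\<close> with \<open>modulus d r\<close> dividing \<open>c\<close>, as in Goedel's beta
  function.  If \<open>d\<close> is a common multiple of \<open>1, \<dots>, n\<close>, the moduli below \<open>n\<close> are pairwise coprime,
  which lemma \<open>dvd_modulus_mult\<close> expresses without greatest common divisors.\<close>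

definition modulus :: "'a \<Rightarrow> 'a \<Rightarrow> 'a" where
  "modulus d r = one \<oplus> (r \<oplus> one) \<otimes> d"

definition code :: "'a \<Rightarrow> 'a \<Rightarrow> 'a \<Rightarrow> bool" where
  "code c d r \<longleftrightarrow> ar.dvd (modulus d r) c"

text \<open>A quotient need not exceed the dividend, so divisibility is a bounded formula. For
  divisor zero the given quotient may be large and is replaced by zero.\<close>

lemma dvd_bounded: "ar.dvd a b \<longleftrightarrow> (\<exists>q. q \<prec> b \<oplus> one \<and> b = a \<otimes> q)"
proof
  assume "ar.dvd a b"
  then obtain q where q: "b = a \<otimes> q" unfolding ar.dvd_def by blast
  show "\<exists>q. q \<prec> b \<oplus> one \<and> b = a \<otimes> q"
  proof (cases "a = zero")
    case True
    then show ?thesis using q by (intro exI[of _ zero]) (simp add: less_Suc)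
  next
    case False
    then have "one \<otimes> q \<preceq> a \<otimes> q"
      using Suc_le[of zero a] by (intro ar.mult_right_mono) (simp_all add: add_zero_left pos_iff)
    then show ?thesis using q by (auto simp: less_Suc)
  qed
qed (auto simp: ar.dvd_def)

lemma D0_dvd: "term_def f \<Longrightarrow> term_def g \<Longrightarrow> D0 (\<lambda>e. ar.dvd (f e) (g e))"
  by (rule D0_subst2[of "\<lambda>a b. ar.dvd a b"]) (unfold dvd_bounded, intro D0_intros)

lemma D0_code: "term_def f \<Longrightarrow> term_def g \<Longrightarrow> term_def h \<Longrightarrow> D0 (\<lambda>e. code (f e) (g e) (h e))"
  unfolding code_def modulus_def by (intro D0_dvd D0_intros)

text \<open>A stand-in for the factorial, built by multiplying with the next number. Positivity
  rules out the trivial common multiple zero.\<close>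

lemma common_multiple: "\<exists>d. zero \<prec> d \<and> (\<forall>i. i \<prec> n \<longrightarrow> ar.dvd (i \<oplus> one) d)"
proof (rule Sigma1_induct[of "\<lambda>d n. zero \<prec> d \<and> (\<forall>i. i \<prec> n \<longrightarrow> ar.dvd (i \<oplus> one) d)"])
  show "D0 (\<lambda>e. zero \<prec> e 0 \<and> (\<forall>i. i \<prec> e 1 \<longrightarrow> ar.dvd (i \<oplus> one) (e 0)))"
    by (intro D0_intros D0_dvd)
  show "\<exists>d. zero \<prec> d \<and> (\<forall>i. i \<prec> zero \<longrightarrow> ar.dvd (i \<oplus> one) d)"
    using basic(7) ar.zero_less_one by blast
next
  fix n assume "\<exists>d. zero \<prec> d \<and> (\<forall>i. i \<prec> n \<longrightarrow> ar.dvd (i \<oplus> one) d)"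
  then obtain d where d: "zero \<prec> d" "\<And>i. i \<prec> n \<Longrightarrow> ar.dvd (i \<oplus> one) d" by blast
  have "zero \<prec> n \<oplus> one" by (simp add: less_Suc)
  then have "zero \<prec> d \<otimes> (n \<oplus> one)" using d(1) by (rule ar.mult_pos_pos[rotated])
  moreover have "ar.dvd (i \<oplus> one) (d \<otimes> (n \<oplus> one))" if "i \<prec> n \<oplus> one" for i
    using that d(2)[of i] unfolding basic(8) by (auto simp del: basic)
  ultimately show "\<exists>d. zero \<prec> d \<and> (\<forall>i. i \<prec> n \<oplus> one \<longrightarrow> ar.dvd (i \<oplus> one) d)" by blast
qed

text \<open>Modulo \<open>modulus d i\<close> the product of \<open>d\<close> and
  \<open>i \<oplus> one\<close> is minus one, so \<open>d\<close> is a unit.\<close>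

lemma dvd_modulus_cancel:
  assumes "ar.dvd (modulus d i) (x \<otimes> d)"
  shows "ar.dvd (modulus d i) x"
proof -
  have "x \<otimes> modulus d i = ((x \<otimes> d) \<otimes> (i \<oplus> one)) \<oplus> x"
    by (simp add: modulus_def algebra_simps)
  moreover have "ar.dvd (modulus d i) (x \<otimes> modulus d i)" by simp
  ultimately show ?thesis using assms by (metis ar.dvd_add_right_iff ar.dvd_mult2)
qed

lemma modulus_add: "modulus d (i \<oplus> e) = modulus d i \<oplus> (e \<otimes> d)"
  by (simp add: modulus_def algebra_simps)

text \<open>The two moduli differ by \<open>(e \<oplus> one) \<otimes> d\<close>, where
  \<open>e \<oplus> one\<close> is the distance of \<open>i\<close> and \<open>k\<close>. Hence
  \<open>modulus d i\<close> divides \<open>c\<close> times this difference, and \<open>d\<close>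
  cancels. As \<open>e \<prec> n\<close>, the factor \<open>e \<oplus> one\<close> divides
  \<open>d\<close>, so the modulus divides \<open>c \<otimes> d\<close>, and \<open>d\<close>
  cancels again.\<close>

lemma dvd_modulus_mult:
  assumes d: "\<And>i. i \<prec> n \<Longrightarrow> ar.dvd (i \<oplus> one) d" and i: "i \<prec> n" and k: "k \<prec> n" and ne: "i \<noteq> k"
    and dvd: "ar.dvd (modulus d i) (c \<otimes> modulus d k)"
  shows "ar.dvd (modulus d i) c"
proof -
  obtain e where e: "e \<prec> n" and *: "k = i \<oplus> (e \<oplus> one) \<or> i = k \<oplus> (e \<oplus> one)"
  proof (cases "i \<prec> k")
    case True
    then obtain e where "k = i \<oplus> (e \<oplus> one)" unfolding less_iff by blast
    moreover from this have "e \<preceq> k" by (simp add: algebra_simps le_iff) (metis add_commute add_left_commute)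
    ultimately show ?thesis using k that ar.le_less_trans by blast
  next
    case False
    then have "k \<prec> i" using ne less_total by blast
    then obtain e where "i = k \<oplus> (e \<oplus> one)" unfolding less_iff by blast
    moreover from this have "e \<preceq> i" by (simp add: algebra_simps le_iff) (metis add_commute add_left_commute)
    ultimately show ?thesis using i that ar.le_less_trans by blast
  qed
  have "ar.dvd (modulus d i) (c \<otimes> modulus d i)" by simp
  moreover from * have "c \<otimes> modulus d k = (c \<otimes> modulus d i) \<oplus> (c \<otimes> ((e \<oplus> one) \<otimes> d)) \<or>
    c \<otimes> modulus d i = (c \<otimes> modulus d k) \<oplus> (c \<otimes> ((e \<oplus> one) \<otimes> d))"
    by (auto simp: modulus_add distrib simp del: basic)
  ultimately have "ar.dvd (modulus d i) (c \<otimes> ((e \<oplus> one) \<otimes> d))"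
    using dvd ar.dvd_add_right_iff by metis
  then have "ar.dvd (modulus d i) ((c \<otimes> (e \<oplus> one)) \<otimes> d)" by (simp only: mul_assoc)
  then have "ar.dvd (modulus d i) (c \<otimes> (e \<oplus> one))" by (rule dvd_modulus_cancel)
  moreover obtain q where "d = (e \<oplus> one) \<otimes> q" using d[OF e] unfolding ar.dvd_def by blast
  ultimately have "ar.dvd (modulus d i) (c \<otimes> d)" by (metis ar.dvd_mult2 mul_assoc)
  then show ?thesis by (rule dvd_modulus_cancel)
qed

text \<open>With \<open>d\<close> fixed, \<open>c\<close> is the product of the moduli of the
  elements of \<open>X\<close> below \<open>k\<close>, formed by induction on \<open>k\<close>;
  coprimality guarantees that a new factor changes only its own bit.\<close>

lemma code_exists: "\<exists>c d. \<forall>i. i \<prec> n \<longrightarrow> (code c d i \<longleftrightarrow> mem i X)"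
proof -
  obtain d where d: "zero \<prec> d" "\<And>i. i \<prec> n \<Longrightarrow> ar.dvd (i \<oplus> one) d" using common_multiple by blast
  have "\<exists>c. \<forall>i. i \<prec> n \<longrightarrow> (code c d i \<longleftrightarrow> i \<prec> k \<and> mem i X)" for k
  proof (rule Sigma1_induct[of "\<lambda>c k. \<forall>i. i \<prec> n \<longrightarrow> (code c d i \<longleftrightarrow> i \<prec> k \<and> mem i X)"])
    show "D0 (\<lambda>e. \<forall>i. i \<prec> n \<longrightarrow> (code (e 0) d i \<longleftrightarrow> i \<prec> e 1 \<and> mem i X))"
      by (intro D0_intros D0_code)
    \<comment> \<open>The empty product codes the empty set: as \<open>d\<close> is positive, every
      modulus exceeds one.\<close>
    have "\<not> code one d i" for i
    proof
      assume "code one d i"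
      then obtain q where "one = modulus d i \<otimes> q" unfolding code_def ar.dvd_def by blast
      moreover have "one \<prec> modulus d i" unfolding modulus_def using d(1) by (simp add: pos_iff basic(1))
      moreover have "modulus d i \<otimes> one \<preceq> modulus d i \<otimes> q" if "q \<noteq> zero"
        using that Suc_le[of zero q] by (intro ar.mult_left_mono) (simp_all add: pos_iff add_zero_left)
      ultimately show False using less_irrefl[of one] ar.le_less_trans by (cases "q = zero") fastforce+
    qed
    then show "\<exists>c. \<forall>i. i \<prec> n \<longrightarrow> (code c d i \<longleftrightarrow> i \<prec> zero \<and> mem i X)" using basic(7) by blast
  next
    fix k assume "\<exists>c. \<forall>i. i \<prec> n \<longrightarrow> (code c d i \<longleftrightarrow> i \<prec> k \<and> mem i X)"
    then obtain c where c: "\<And>i. i \<prec> n \<Longrightarrow> code c d i \<longleftrightarrow> i \<prec> k \<and> mem i X" by blast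
    show "\<exists>c. \<forall>i. i \<prec> n \<longrightarrow> (code c d i \<longleftrightarrow> i \<prec> k \<oplus> one \<and> mem i X)"
    proof (cases "mem k X \<and> k \<prec> n")
      case True
      have "code (c \<otimes> modulus d k) d i \<longleftrightarrow> i \<prec> k \<oplus> one \<and> mem i X" if i: "i \<prec> n" for i
      proof (cases "i = k")
        case True
        then show ?thesis using \<open>mem k X \<and> k \<prec> n\<close> by (simp add: code_def basic(8))
      next
        case False
        then have "code (c \<otimes> modulus d k) d i \<longleftrightarrow> code c d i"
          unfolding code_def using dvd_modulus_mult[of n d i k c] d(2) i True by auto
        then show ?thesis using c[OF i] False by (simp add: basic(8))
      qed
      then show ?thesis by blast
    next
      case False
      then show ?thesis using c by (intro exI[of _ c]) (auto simp: basic(8))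
    qed
  qed
  from this[of n] show ?thesis by blast
qed

text \<open>\<open>\<Phi>\<close> acts on predicates, but \<open>D0\<close> speaks of numbers only,
  so definability is required for coded predicates. \<open>G c d s\<close> below says that the code
  is a correct computation up to \<open>s\<close>. Such computations exist for every length and
  agree where they overlap, because \<open>\<Phi>\<close> looks only at smaller arguments.\<close>

theorem course_of_values_recursion:
  assumes D0: "D0 (\<lambda>e. \<Phi> (code (e 0) (e 1)) (e 2))"
    and local: "\<And>P Q s. (\<And>r. r \<prec> s \<Longrightarrow> P r \<longleftrightarrow> Q r) \<Longrightarrow> \<Phi> P s \<longleftrightarrow> \<Phi> Q s"
  shows "\<exists>B. \<forall>s. mem s B \<longleftrightarrow> \<Phi> (\<lambda>r. mem r B) s"
proof -
  note D0_\<Phi> = D0_subst3[OF D0]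
  define G where "G = (\<lambda>c d s. \<forall>r. r \<prec> s \<longrightarrow> (code c d r \<longleftrightarrow> \<Phi> (code c d) r))"
  have "D0 (\<lambda>e. G (e 0) (e 1) (e 2))"
    unfolding G_def by (intro D0_intros D0_code D0_\<Phi>)
  note D0_G = D0_subst3[OF this]
  have bound: "\<exists>b. c \<prec> b \<and> d \<prec> b" for c d
    by (intro exI[of _ "(c \<oplus> d) \<oplus> one"]) (simp add: less_Suc)
  \<comment> \<open>The common bound \<open>b\<close> replaces the two witnesses \<open>c\<close>
    and \<open>d\<close> by one unbounded quantifier.\<close>
  have "\<exists>b. \<exists>c. c \<prec> b \<and> (\<exists>d. d \<prec> b \<and> G c d s)" for s
  proof (rule Sigma1_induct[of "\<lambda>b s. \<exists>c. c \<prec> b \<and> (\<exists>d. d \<prec> b \<and> G c d s)"])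
    show "D0 (\<lambda>e. \<exists>c. c \<prec> e 0 \<and> (\<exists>d. d \<prec> e 0 \<and> G c d (e 1)))"
      by (intro D0_intros D0_G)
    have "G zero zero zero" by (simp add: G_def basic(7))
    then show "\<exists>b. \<exists>c. c \<prec> b \<and> (\<exists>d. d \<prec> b \<and> G c d zero)" using ar.zero_less_one by blast
  next
    fix s assume "\<exists>b. \<exists>c. c \<prec> b \<and> (\<exists>d. d \<prec> b \<and> G c d s)"
    then obtain c d where G: "G c d s" by blast
    \<comment> \<open>The old \<open>d\<close> need not suit the longer initial segment, so the
      extended computation is first formed as a set and then coded afresh.\<close>
    have "\<exists>X. \<forall>r. mem r X \<longleftrightarrow> code c d r \<and> r \<prec> s \<or> \<Phi> (code c d) r \<and> r = s"
      by (rule D0_comprehension) (intro D0_intros D0_code D0_\<Phi>)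
    then obtain X where X: "\<And>r. mem r X \<longleftrightarrow> code c d r \<and> r \<prec> s \<or> \<Phi> (code c d) r \<and> r = s" by blast
    obtain c' d' where c': "\<And>r. r \<prec> s \<oplus> one \<Longrightarrow> code c' d' r \<longleftrightarrow> mem r X"
      using code_exists[of "s \<oplus> one" X] by blast
    have below: "code c' d' r \<longleftrightarrow> code c d r" if "r \<prec> s" for r
      using c'[of r] X[of r] that less_irrefl by (auto simp: basic(8))
    have "code c' d' r \<longleftrightarrow> \<Phi> (code c' d') r" if "r \<prec> s \<oplus> one" for r
    proof -
      have le: "r \<prec> s \<or> r = s" using that by (simp add: basic(8))
      then have "\<Phi> (code c' d') r \<longleftrightarrow> \<Phi> (code c d) r"
        using below less_trans by (intro local) blast
      moreover have "code c' d' r \<longleftrightarrow> \<Phi> (code c d) r"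
      proof (cases "r = s")
        case True
        then show ?thesis using c'[OF that] X[of r] less_irrefl by simp
      next
        case False
        then show ?thesis using below[of r] le G by (simp add: G_def)
      qed
      ultimately show ?thesis by simp
    qed
    then have "G c' d' (s \<oplus> one)" by (simp add: G_def)
    moreover obtain b where "c' \<prec> b" "d' \<prec> b" using bound by blast
    ultimately show "\<exists>b. \<exists>c. c \<prec> b \<and> (\<exists>d. d \<prec> b \<and> G c d (s \<oplus> one))" by blast
  qed
  then have G_exists: "\<exists>c d. G c d s" for s by blast
  have unique: "code c d r \<longleftrightarrow> code c' d' r" if G: "G c d s" "G c' d' s'" "r \<prec> s" "r \<prec> s'" for c d s c' d' s' r
  proof -
    have "\<forall>r. r \<prec> x \<longrightarrow> r \<prec> s \<longrightarrow> r \<prec> s' \<longrightarrow> (code c d r \<longleftrightarrow> code c' d' r)" for x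
    proof (induction x rule: D0_induct)
      case definable
      show ?case by (intro D0_intros D0_code)
    next
      case zero
      then show ?case by (simp add: basic(7))
    next
      case (Suc x)
      have "code c d x \<longleftrightarrow> code c' d' x" if x: "x \<prec> s" "x \<prec> s'"
      proof -
        have "\<Phi> (code c d) x \<longleftrightarrow> \<Phi> (code c' d') x"
          by (rule local) (use Suc x less_trans in blast)
        then show ?thesis using G(1,2) x by (simp add: G_def)
      qed
      then show ?case using Suc by (auto simp: basic(8))
    qed
    from this[of "r \<oplus> one"] show ?thesis using that(3,4) by (simp add: basic(8))
  qed
  \<comment> \<open>By existence and uniqueness, some computation accepts \<open>s\<close> exactly
    when all computations of sufficient length do; this makes \<open>B\<close> Delta-1.\<close>
  have "\<exists>B. \<forall>s. mem s B \<longleftrightarrow> (\<exists>b. \<exists>c. c \<prec> b \<and> (\<exists>d. d \<prec> b \<and> (G c d (s \<oplus> one) \<and> code c d s)))"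
  proof (rule Delta1_comprehension)
    show "D0 (\<lambda>e. \<exists>c. c \<prec> e 0 \<and> (\<exists>d. d \<prec> e 0 \<and> (G c d (e 1 \<oplus> one) \<and> code c d (e 1))))"
      by (intro D0_intros D0_G D0_code)
    show "D0 (\<lambda>e. \<forall>c. c \<prec> e 0 \<longrightarrow> (\<forall>d. d \<prec> e 0 \<longrightarrow> (G c d (e 1 \<oplus> one) \<longrightarrow> code c d (e 1))))"
      by (intro D0_intros D0_G D0_code)
  next
    fix s
    show "(\<exists>b. \<exists>c. c \<prec> b \<and> (\<exists>d. d \<prec> b \<and> (G c d (s \<oplus> one) \<and> code c d s))) \<longleftrightarrow>
      (\<forall>b. \<forall>c. c \<prec> b \<longrightarrow> (\<forall>d. d \<prec> b \<longrightarrow> (G c d (s \<oplus> one) \<longrightarrow> code c d s)))" (is "?l \<longleftrightarrow> ?r")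
    proof
      assume ?l
      then obtain c d where c: "G c d (s \<oplus> one)" "code c d s" by blast
      have "code c' d' s" if "G c' d' (s \<oplus> one)" for c' d'
        using unique[OF c(1) that, of s] c(2) by (simp add: basic(8))
      then show ?r by blast
    next
      assume r: ?r
      obtain c d where "G c d (s \<oplus> one)" using G_exists by blast
      moreover obtain b where "c \<prec> b" "d \<prec> b" using bound by blast
      ultimately show ?l using r by blast
    qed
  qed
  then obtain B where B: "\<And>s. mem s B \<longleftrightarrow> (\<exists>b. \<exists>c. c \<prec> b \<and> (\<exists>d. d \<prec> b \<and> (G c d (s \<oplus> one) \<and> code c d s)))"
    by blast
  have mem_B: "mem r B \<longleftrightarrow> code c d r" if "G c d s" "r \<prec> s" for c d r s
  proof
    assume "mem r B"
    then obtain c' d' where "G c' d' (r \<oplus> one)" "code c' d' r" using B by blast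
    then show "code c d r" using unique[OF that(1) _ that(2), of c' d' "r \<oplus> one"] by (simp add: basic(8))
  next
    assume "code c d r"
    moreover obtain c' d' where c': "G c' d' (r \<oplus> one)" using G_exists by blast
    ultimately have "code c' d' r" using unique[OF that(1) c' that(2)] by (simp add: basic(8))
    then show "mem r B" using B c' bound by blast
  qed
  have "mem s B \<longleftrightarrow> \<Phi> (\<lambda>r. mem r B) s" for s
  proof -
    obtain c d where G: "G c d (s \<oplus> one)" using G_exists by blast
    then have "mem s B \<longleftrightarrow> \<Phi> (code c d) s" using mem_B[OF G, of s] by (simp add: G_def basic(8))
    also have "\<dots> \<longleftrightarrow> \<Phi> (\<lambda>r. mem r B) s"
      by (rule local) (simp add: mem_B[OF G] basic(8))
    finally show ?thesis .
  qed
  then show ?thesis by blast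
qed

end

section \<open>Colorings in a model\<close>

context BSigma02_model
begin

definition colored :: "'b \<Rightarrow> 'a \<Rightarrow> 'a \<Rightarrow> 'a \<Rightarrow> bool" where
  "colored F x s y \<longleftrightarrow> mem (pr (pr x s) y) F"

definition is_coloring :: "'b \<Rightarrow> bool" where
  "is_coloring F \<longleftrightarrow> (\<forall>n. mem n F \<longrightarrow> (\<exists>x s y. x \<prec> s \<and> n = pr (pr x s) y)) \<and>
    (\<forall>x s. x \<prec> s \<longrightarrow> (\<exists>y. colored F x s y)) \<and>
    (\<forall>x s y z. colored F x s y \<longrightarrow> colored F x s z \<longrightarrow> y = z)"

definition is_infinite :: "'b \<Rightarrow> bool" where
  "is_infinite A \<longleftrightarrow> (\<forall>m. \<exists>n. m \<prec> n \<and> mem n A)"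

definition is_stable :: "'b \<Rightarrow> bool" where
  "is_stable F \<longleftrightarrow> (\<forall>x. \<exists>y m. \<forall>s. m \<prec> s \<and> x \<prec> s \<longrightarrow> colored F x s y)"

definition is_free :: "'b \<Rightarrow> 'b \<Rightarrow> bool" where
  "is_free A F \<longleftrightarrow> (\<forall>x s y. mem x A \<and> mem s A \<and> x \<prec> s \<and> colored F x s y \<and> mem y A \<longrightarrow> y = x \<or> y = s)"

definition is_two_bounded :: "'b \<Rightarrow> bool" where
  "is_two_bounded F \<longleftrightarrow> (\<forall>y x\<^sub>1 s\<^sub>1 x\<^sub>2 s\<^sub>2 x\<^sub>3 s\<^sub>3.
    x\<^sub>1 \<prec> s\<^sub>1 \<and> x\<^sub>2 \<prec> s\<^sub>2 \<and> x\<^sub>3 \<prec> s\<^sub>3 \<and> colored F x\<^sub>1 s\<^sub>1 y \<and> colored F x\<^sub>2 s\<^sub>2 y \<and> colored F x\<^sub>3 s\<^sub>3 y \<longrightarrow>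
    x\<^sub>1 = x\<^sub>2 \<and> s\<^sub>1 = s\<^sub>2 \<or> x\<^sub>1 = x\<^sub>3 \<and> s\<^sub>1 = s\<^sub>3 \<or> x\<^sub>2 = x\<^sub>3 \<and> s\<^sub>2 = s\<^sub>3)"

definition same_color :: "'b \<Rightarrow> 'a \<Rightarrow> 'a \<Rightarrow> 'a \<Rightarrow> 'a \<Rightarrow> bool" where
  "same_color F x s y t \<longleftrightarrow> (\<exists>v. colored F x s v \<and> colored F y t v)"

definition is_weakly_rainbow_stable :: "'b \<Rightarrow> bool" where
  "is_weakly_rainbow_stable F \<longleftrightarrow> (\<forall>x y.
    (\<exists>m. \<forall>s. m \<prec> s \<and> x \<prec> s \<and> y \<prec> s \<longrightarrow> same_color F x s y s) \<or>
    (\<exists>m. \<forall>s. m \<prec> s \<and> x \<prec> s \<and> y \<prec> s \<longrightarrow> \<not> same_color F x s y s))"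

definition is_rainbow :: "'b \<Rightarrow> 'b \<Rightarrow> bool" where
  "is_rainbow R F \<longleftrightarrow> (\<forall>x\<^sub>1 s\<^sub>1 x\<^sub>2 s\<^sub>2 y. mem x\<^sub>1 R \<and> mem s\<^sub>1 R \<and> x\<^sub>1 \<prec> s\<^sub>1 \<and> mem x\<^sub>2 R \<and> mem s\<^sub>2 R \<and> x\<^sub>2 \<prec> s\<^sub>2 \<and>
    colored F x\<^sub>1 s\<^sub>1 y \<and> colored F x\<^sub>2 s\<^sub>2 y \<longrightarrow> x\<^sub>1 = x\<^sub>2 \<and> s\<^sub>1 = s\<^sub>2)"

lemma sat_colorings:
  "sat e S (coloring i) \<longleftrightarrow> is_coloring (S i)"
  "sat e S (infinite_set i) \<longleftrightarrow> is_infinite (S i)"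
  "sat e S (stable i) \<longleftrightarrow> is_stable (S i)"
  "sat e S (free_set j i) \<longleftrightarrow> is_free (S j) (S i)"
  "sat e S (two_bounded i) \<longleftrightarrow> is_two_bounded (S i)"
  "sat e S (weakly_rainbow_stable i) \<longleftrightarrow> is_weakly_rainbow_stable (S i)"
  "sat e S (rainbow j i) \<longleftrightarrow> is_rainbow (S j) (S i)"
proof -
  note [simp] = Let_def val_def colored_def eval_nat_numeral
  show "sat e S (coloring i) \<longleftrightarrow> is_coloring (S i)"
    by (simp add: coloring_def is_coloring_def) blast
  show "sat e S (infinite_set i) \<longleftrightarrow> is_infinite (S i)"
    by (simp add: infinite_set_def is_infinite_def)
  show "sat e S (stable i) \<longleftrightarrow> is_stable (S i)"
    by (simp add: stable_def is_stable_def)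
  show "sat e S (free_set j i) \<longleftrightarrow> is_free (S j) (S i)"
    by (simp add: free_set_def is_free_def)
  show "sat e S (two_bounded i) \<longleftrightarrow> is_two_bounded (S i)"
    by (simp add: two_bounded_def is_two_bounded_def)
  show "sat e S (weakly_rainbow_stable i) \<longleftrightarrow> is_weakly_rainbow_stable (S i)"
    by (simp add: weakly_rainbow_stable_def agree_def is_weakly_rainbow_stable_def same_color_def)
  show "sat e S (rainbow j i) \<longleftrightarrow> is_rainbow (S j) (S i)"
    by (simp add: rainbow_def is_rainbow_def)
qed

lemma sat_SFS2: "sat e S SFS2 \<longleftrightarrow>
    (\<forall>F. is_coloring F \<longrightarrow> is_stable F \<longrightarrow> (\<exists>A. is_infinite A \<and> is_free A F))"
  by (simp add: SFS2_def sat_colorings imp_conjL)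

lemma sat_WSRRT22: "sat e S WSRRT22 \<longleftrightarrow>
    (\<forall>F. is_coloring F \<longrightarrow> is_two_bounded F \<longrightarrow> is_weakly_rainbow_stable F \<longrightarrow>
      (\<exists>R. is_infinite R \<and> is_rainbow R F))"
  by (simp add: WSRRT22_def sat_colorings imp_conjL)

lemma pr_bounds: "i \<prec> pr i j \<oplus> one" "j \<prec> pr i j \<oplus> one"
  "i \<prec> pr (pr i j) k \<oplus> one" "j \<prec> pr (pr i j) k \<oplus> one"
  "i \<prec> pr k (pr i j) \<oplus> one" "j \<prec> pr k (pr i j) \<oplus> one"
  unfolding less_Suc using pr_ge ar.order_trans by blast+

lemmas D0_all = D0_intros D0_le D0_code term_pr

lemma is_coloringD:
  assumes "is_coloring F"
  shows "colored F x s y \<Longrightarrow> x \<prec> s" "x \<prec> s \<Longrightarrow> \<exists>y. colored F x s y"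
    "colored F x s y \<Longrightarrow> colored F x s z \<Longrightarrow> y = z"
proof -
  assume "colored F x s y"
  then obtain x' s' y' where "x' \<prec> s'" "pr (pr x s) y = pr (pr x' s') y'"
    using assms unfolding is_coloring_def colored_def by blast
  then show "x \<prec> s" by simp
qed (use assms in \<open>unfold is_coloring_def, blast\<close>)+

text \<open>Existential form: some color is shared. Universal form: whatever colors
  \<open>(x, s)\<close> also colors \<open>(y, t)\<close>. They agree because each pair has exactly
  one color, so Delta-1 comprehension applies.\<close>

lemma same_color_set:
  assumes F: "is_coloring F"
  shows "\<exists>C. \<forall>x s y t. mem (pr (pr x s) (pr y t)) C \<longleftrightarrow> same_color F x s y t"
proof -
  have "\<exists>C. \<forall>n. mem n C \<longleftrightarrow> (\<exists>v. \<exists>x. x \<prec> n \<oplus> one \<and> (\<exists>s. s \<prec> n \<oplus> one \<and> (\<exists>y. y \<prec> n \<oplus> one \<and> (\<exists>t. t \<prec> n \<oplus> one \<and>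
    (n = pr (pr x s) (pr y t) \<and> colored F x s v \<and> colored F y t v)))))"
  proof (rule Delta1_comprehension)
    show "D0 (\<lambda>e. \<exists>x. x \<prec> e 1 \<oplus> one \<and> (\<exists>s. s \<prec> e 1 \<oplus> one \<and> (\<exists>y. y \<prec> e 1 \<oplus> one \<and> (\<exists>t. t \<prec> e 1 \<oplus> one \<and>
      (e 1 = pr (pr x s) (pr y t) \<and> colored F x s (e 0) \<and> colored F y t (e 0))))))"
      unfolding colored_def by (intro D0_all)
    \<comment> \<open>The conjunct \<open>x \<prec> s\<close> keeps the universal form from holding
      vacuously where \<open>(x, s)\<close> has no color.\<close>
    show "D0 (\<lambda>e. \<exists>x. x \<prec> e 1 \<oplus> one \<and> (\<exists>s. s \<prec> e 1 \<oplus> one \<and> (\<exists>y. y \<prec> e 1 \<oplus> one \<and> (\<exists>t. t \<prec> e 1 \<oplus> one \<and>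
      (e 1 = pr (pr x s) (pr y t) \<and> x \<prec> s \<and> y \<prec> t \<and> (colored F x s (e 0) \<longrightarrow> colored F y t (e 0)))))))"
      unfolding colored_def by (intro D0_all)
  next
    fix n
    show "(\<exists>v. \<exists>x. x \<prec> n \<oplus> one \<and> (\<exists>s. s \<prec> n \<oplus> one \<and> (\<exists>y. y \<prec> n \<oplus> one \<and> (\<exists>t. t \<prec> n \<oplus> one \<and>
        (n = pr (pr x s) (pr y t) \<and> colored F x s v \<and> colored F y t v))))) \<longleftrightarrow>
      (\<forall>v. \<exists>x. x \<prec> n \<oplus> one \<and> (\<exists>s. s \<prec> n \<oplus> one \<and> (\<exists>y. y \<prec> n \<oplus> one \<and> (\<exists>t. t \<prec> n \<oplus> one \<and>
        (n = pr (pr x s) (pr y t) \<and> x \<prec> s \<and> y \<prec> t \<and> (colored F x s v \<longrightarrow> colored F y t v))))))"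
      (is "?l \<longleftrightarrow> ?r")
    proof
      assume ?l
      then obtain v x s y t where "x \<prec> n \<oplus> one" "s \<prec> n \<oplus> one" "y \<prec> n \<oplus> one" "t \<prec> n \<oplus> one"
        "n = pr (pr x s) (pr y t)" and v: "colored F x s v" "colored F y t v" by blast
      moreover have "x \<prec> s" "y \<prec> t" using v is_coloringD[OF F] by blast+
      moreover have "colored F y t w" if "colored F x s w" for w
        using v is_coloringD(3)[OF F v(1) that] by simp
      ultimately show ?r by blast
    next
      assume r: ?r
      then obtain x s y t where b: "x \<prec> n \<oplus> one" "s \<prec> n \<oplus> one" "y \<prec> n \<oplus> one" "t \<prec> n \<oplus> one"
        and n: "n = pr (pr x s) (pr y t)" and "x \<prec> s" by blast
      obtain v where v: "colored F x s v" using is_coloringD(2)[OF F \<open>x \<prec> s\<close>] by blast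
      \<comment> \<open>The components supplied for this \<open>v\<close> are the ones already
        fixed, by injectivity of \<open>pr\<close>.\<close>
      then have "colored F y t v" using spec[OF r, of v] unfolding n pr_inject by blast
      then show ?l using b n v by blast
    qed
  qed
  then obtain C where C: "\<And>n. mem n C \<longleftrightarrow> (\<exists>v. \<exists>x. x \<prec> n \<oplus> one \<and> (\<exists>s. s \<prec> n \<oplus> one \<and> (\<exists>y. y \<prec> n \<oplus> one \<and> (\<exists>t. t \<prec> n \<oplus> one \<and>
    (n = pr (pr x s) (pr y t) \<and> colored F x s v \<and> colored F y t v)))))" by blast
  have "mem (pr (pr x s) (pr y t)) C \<longleftrightarrow> same_color F x s y t" for x s y t
  proof
    assume "mem (pr (pr x s) (pr y t)) C"
    then show "same_color F x s y t" unfolding C same_color_def pr_inject by blast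
  next
    assume v: "same_color F x s y t"
    define n where "n = pr (pr x s) (pr y t)"
    have "x \<prec> n \<oplus> one" "s \<prec> n \<oplus> one" "y \<prec> n \<oplus> one" "t \<prec> n \<oplus> one"
      unfolding n_def by (rule pr_bounds)+
    then have "mem n C" using v n_def unfolding C same_color_def by blast
    then show "mem (pr (pr x s) (pr y t)) C" by (simp add: n_def)
  qed
  then show ?thesis by blast
qed

end

section \<open>The auxiliary coloring and the greedy thinning\<close>

locale rainbow_stable = BSigma02_model +
  fixes F C
  assumes F: "is_coloring F" and two: "is_two_bounded F" and wrs: "is_weakly_rainbow_stable F"
    and C: "\<And>x s y t. mem (pr (pr x s) (pr y t)) C \<longleftrightarrow> same_color F x s y t"
begin

lemma D0_same:
  assumes "term_def f" "term_def g" "term_def f'" "term_def g'"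
  shows "D0 (\<lambda>e. same_color F (f e) (g e) (f' e) (g' e))"
  unfolding C[symmetric] using assms by (intro D0_all)

lemma same_color_less: "same_color F x s y t \<Longrightarrow> x \<prec> s \<and> y \<prec> t"
  unfolding same_color_def using is_coloringD[OF F] by blast

lemma same_color_two:
  assumes "same_color F x s y t" "same_color F x s z u"
  shows "x = y \<and> s = t \<or> x = z \<and> s = u \<or> y = z \<and> t = u"
proof -
  obtain v w where v: "colored F x s v" "colored F y t v" "colored F x s w" "colored F z u w"
    using assms unfolding same_color_def by blast
  have "w = v" using is_coloringD(3)[OF F v(3,1)] .
  moreover have "x \<prec> s" "y \<prec> t" "z \<prec> u" using assms same_color_less by blast+
  ultimately show ?thesis
    using two[unfolded is_two_bounded_def, rule_format, of x s y t z u v] v by blast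
qed

lemma same_color_sym: "same_color F x s y t \<longleftrightarrow> same_color F y t x s"
  unfolding same_color_def by blast

text \<open>By 2-boundedness a pair \<open>(x, s)\<close> collides with at most one \<open>(y, s)\<close>, \<open>y < x\<close>; \<open>partner x s y\<close>
  says that \<open>y\<close> is this number, with the default value \<open>y = x\<close>.  A set free for this coloring
  contains no collision between two pairs with the same second component.\<close>

definition partner :: "'a \<Rightarrow> 'a \<Rightarrow> 'a \<Rightarrow> bool" where
  "partner x s y \<longleftrightarrow> x \<prec> s \<and>
    (y \<prec> x \<and> same_color F y s x s \<or> y = x \<and> (\<forall>z. z \<prec> x \<longrightarrow> \<not> same_color F z s x s))"

lemma D0_partner:
  assumes "term_def f" "term_def g" "term_def h"
  shows "D0 (\<lambda>e. partner (f e) (g e) (h e))"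
  using _ assms
proof (rule D0_subst3)
  show "D0 (\<lambda>e. partner (e 0) (e 1) (e 2))"
    unfolding partner_def by (intro D0_all D0_same)
qed

text \<open>Two different values below \<open>x\<close> would give three pairs of one color, so the
  value is unique. Since \<open>C\<close> is a parameter, the graph is defined by a bounded
  formula.\<close>

lemma partner_coloring: "\<exists>G. is_coloring G \<and> (\<forall>x s y. colored G x s y \<longleftrightarrow> partner x s y)"
proof -
  have "\<exists>G. \<forall>n. mem n G \<longleftrightarrow> (\<exists>x. x \<prec> n \<oplus> one \<and> (\<exists>s. s \<prec> n \<oplus> one \<and> (\<exists>y. y \<prec> n \<oplus> one \<and>
      (n = pr (pr x s) y \<and> partner x s y))))"
    by (rule D0_comprehension) (intro D0_all D0_partner)
  then obtain G where G: "\<And>n. mem n G \<longleftrightarrow> (\<exists>x. x \<prec> n \<oplus> one \<and> (\<exists>s. s \<prec> n \<oplus> one \<and> (\<exists>y. y \<prec> n \<oplus> one \<and>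
      (n = pr (pr x s) y \<and> partner x s y))))" by blast
  have col: "colored G x s y \<longleftrightarrow> partner x s y" for x s y
  proof
    assume "colored G x s y"
    then show "partner x s y" unfolding colored_def G pr_inject by blast
  next
    assume rel: "partner x s y"
    define n where "n = pr (pr x s) y"
    have "x \<prec> n \<oplus> one" "s \<prec> n \<oplus> one" "y \<prec> n \<oplus> one"
      unfolding n_def by (rule pr_bounds)+
    then have "mem n G" using rel n_def unfolding G by blast
    then show "colored G x s y" by (simp add: colored_def n_def)
  qed
  have "\<exists>y. partner x s y" if "x \<prec> s" for x s
    unfolding partner_def using that by blast
  moreover have "y = z" if "partner x s y" "partner x s z" for x s y z
    using that same_color_two[of x s y s z s] less_irrefl unfolding partner_def
    by (auto simp: same_color_sym[of x s])
  moreover have "\<exists>x s y. x \<prec> s \<and> n = pr (pr x s) y" if "mem n G" for n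
    using that unfolding G partner_def by blast
  ultimately have "is_coloring G" unfolding is_coloring_def col by blast
  then show ?thesis using col by blast
qed

lemma partner_stable: "\<exists>y m. \<forall>s. m \<prec> s \<and> x \<prec> s \<longrightarrow> partner x s y"
proof -
  \<comment> \<open>Both alternatives of weak rainbow-stability say that the truth value is constant
    beyond \<open>m\<close>. The two stages \<open>s\<close> and \<open>t\<close> are bounded by
    \<open>u\<close> to leave one universal quantifier for \<open>Pi1_bounding\<close>.\<close>
  let ?Q = "\<lambda>u m z. \<forall>s. s \<prec> u \<longrightarrow> (\<forall>t. t \<prec> u \<longrightarrow> (m \<prec> s \<and> x \<prec> s \<and> m \<prec> t \<and> x \<prec> t \<longrightarrow>
      (same_color F z s x s \<longleftrightarrow> same_color F z t x t)))"
  have "\<exists>b. \<forall>z. z \<prec> x \<longrightarrow> (\<exists>m. m \<prec> b \<and> (\<forall>u. ?Q u m z))"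
  proof (rule Pi1_bounding[of ?Q])
    show "D0 (\<lambda>e. ?Q (e 0) (e 1) (e 2))"
      by (intro D0_all D0_same)
    fix z assume "z \<prec> x"
    then have zs: "z \<prec> s" if "x \<prec> s" for s using that less_trans by blast
    from wrs[unfolded is_weakly_rainbow_stable_def, rule_format, of z x]
    show "\<exists>m. \<forall>u. ?Q u m z"
      using zs by meson
  qed
  then obtain b where b: "\<And>z. z \<prec> x \<Longrightarrow> \<exists>m. m \<prec> b \<and> (\<forall>u. ?Q u m z)" by blast
  have inv: "same_color F z s x s \<longleftrightarrow> same_color F z t x t"
    if "z \<prec> x" "b \<prec> s" "x \<prec> s" "b \<prec> t" "x \<prec> t" for z s t
  proof -
    obtain m where m: "m \<prec> b" "\<And>u. ?Q u m z" using b[OF \<open>z \<prec> x\<close>] by blast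
    have "s \<prec> (s \<oplus> t) \<oplus> one" "t \<prec> (s \<oplus> t) \<oplus> one" by (simp_all add: less_Suc)
    moreover have "m \<prec> s" "m \<prec> t" using m(1) that less_trans by blast+
    ultimately show ?thesis using m(2)[of "(s \<oplus> t) \<oplus> one"] that by blast
  qed
  \<comment> \<open>Any stage beyond both \<open>b\<close> and \<open>x\<close> shows the limit:
    afterwards no truth value for any \<open>z \<prec> x\<close> changes, so the partner found here
    persists.\<close>
  define s\<^sub>0 where "s\<^sub>0 = (b \<oplus> x) \<oplus> one"
  have s0: "b \<prec> s\<^sub>0" "x \<prec> s\<^sub>0" by (simp_all add: s\<^sub>0_def less_Suc)
  then obtain y where y: "partner x s\<^sub>0 y" unfolding partner_def by blast
  have "partner x s y" if "b \<prec> s" "x \<prec> s" for s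
    using y inv[OF _ s0 that] that unfolding partner_def by blast
  then show ?thesis by blast
qed

text \<open>Collisions between pairs with different second components are removed greedily.  The
  construction cannot stop: a color of a pair below \<open>m\<close> occurs on only one other pair, so
  \<open>\<Pi>\<^sub>1\<close>-bounding makes these finitely many colors useless beyond some point.\<close>

lemma greedy_rainbow:
  assumes inf: "is_infinite A"
    and A: "\<And>x y s. mem x A \<Longrightarrow> mem y A \<Longrightarrow> mem s A \<Longrightarrow> y \<prec> x \<Longrightarrow> x \<prec> s \<Longrightarrow> \<not> same_color F y s x s"
  shows "\<exists>B. is_infinite B \<and> is_rainbow B F"
proof -
  \<comment> \<open>A candidate \<open>s\<close> from \<open>A\<close> is rejected if it forms, with
    a chosen \<open>x\<close>, a pair that repeats the color of a pair chosen earlier. Only elements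
    below \<open>s\<close> are consulted, as the recursion requires.\<close>
  define \<Phi> where "\<Phi> = (\<lambda>P s. mem s A \<and> \<not> (\<exists>t. t \<prec> s \<and> (\<exists>y. y \<prec> s \<and> (\<exists>x. x \<prec> s \<and>
    (P y \<and> P t \<and> P x \<and> same_color F y t x s)))))"
  have "\<exists>B. \<forall>s. mem s B \<longleftrightarrow> \<Phi> (\<lambda>r. mem r B) s"
  proof (rule course_of_values_recursion)
    show "D0 (\<lambda>e. \<Phi> (code (e 0) (e 1)) (e 2))"
      unfolding \<Phi>_def by (intro D0_all D0_same)
    show "\<Phi> P s \<longleftrightarrow> \<Phi> Q s" if "\<And>r. r \<prec> s \<Longrightarrow> P r \<longleftrightarrow> Q r" for P Q s
      using that unfolding \<Phi>_def by blast
  qed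
  then obtain B where B: "\<And>s. mem s B \<longleftrightarrow> \<Phi> (\<lambda>r. mem r B) s" by blast
  have BA: "mem s A" if "mem s B" for s using that unfolding B[of s] by (simp add: \<Phi>_def)
  have conflict: "\<not> same_color F y t x s" if "mem y B" "mem t B" "mem x B" "mem s B" "t \<prec> s" for y t x s
  proof
    assume c: "same_color F y t x s"
    then have "y \<prec> s" "x \<prec> s" using same_color_less[OF c] \<open>t \<prec> s\<close> less_trans by blast+
    then show False using that c unfolding B[of s] \<Phi>_def by blast
  qed
  have "is_rainbow B F"
    unfolding is_rainbow_def
  proof (intro allI impI, elim conjE)
    fix x\<^sub>1 s\<^sub>1 x\<^sub>2 s\<^sub>2 y
    assume m: "mem x\<^sub>1 B" "mem s\<^sub>1 B" "mem x\<^sub>2 B" "mem s\<^sub>2 B" and less: "x\<^sub>1 \<prec> s\<^sub>1" "x\<^sub>2 \<prec> s\<^sub>2"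
      and y: "colored F x\<^sub>1 s\<^sub>1 y" "colored F x\<^sub>2 s\<^sub>2 y"
    have c: "same_color F x\<^sub>1 s\<^sub>1 x\<^sub>2 s\<^sub>2" using y unfolding same_color_def by blast
    \<comment> \<open>The recursion excludes collisions with different second components; those with
      equal second components are excluded by the hypothesis on \<open>A\<close>.\<close>
    have "s\<^sub>1 = s\<^sub>2"
      using less_total[of s\<^sub>1 s\<^sub>2] conflict[OF m] conflict[OF m(3,4,1,2)] c same_color_sym by blast
    moreover have "x\<^sub>1 = x\<^sub>2"
      using less_total[of x\<^sub>1 x\<^sub>2] A[of x\<^sub>2 x\<^sub>1 s\<^sub>1] A[of x\<^sub>1 x\<^sub>2 s\<^sub>1] BA m less c same_color_sym calculation by metis
    ultimately show "x\<^sub>1 = x\<^sub>2 \<and> s\<^sub>1 = s\<^sub>2" by simp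
  qed
  moreover have "is_infinite B"
  proof (rule ccontr)
    assume "\<not> is_infinite B"
    then obtain m where m: "\<And>n. mem n B \<Longrightarrow> n \<preceq> m" unfolding is_infinite_def using ar.not_less by blast
    let ?Q = "\<lambda>s b p. \<forall>y. y \<prec> p \<oplus> one \<longrightarrow> (\<forall>t. t \<prec> p \<oplus> one \<longrightarrow> (\<forall>x. x \<prec> s \<longrightarrow>
      (p = pr y t \<and> b \<prec> s \<longrightarrow> \<not> same_color F y t x s)))"
    \<comment> \<open>Pairs are handled through their codes. Two numbers up to \<open>m\<close> have
      sum at most \<open>m \<oplus> m\<close>, less than that of \<open>m \<oplus> one\<close> and
      \<open>m\<close>, so by \<open>pr_less\<close> their code is below
      \<open>pr (m \<oplus> one) m\<close>.\<close>
    have "\<exists>b. \<forall>p. p \<prec> pr (m \<oplus> one) m \<longrightarrow> (\<exists>b'. b' \<prec> b \<and> (\<forall>s. ?Q s b' p))"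
    proof (rule Pi1_bounding[of ?Q])
      show "D0 (\<lambda>e. ?Q (e 0) (e 1) (e 2))"
        by (intro D0_all D0_same)
      fix p
      have "\<exists>b. \<forall>x s. b \<prec> s \<longrightarrow> \<not> same_color F y t x s" for y t
      proof (cases "\<exists>x s. same_color F y t x s \<and> (x, s) \<noteq> (y, t)")
        case True
        then obtain x s where c: "same_color F y t x s" and ne: "(x, s) \<noteq> (y, t)" by blast
        \<comment> \<open>Beyond \<open>s \<oplus> t\<close> the pair \<open>(x', s')\<close> would
          be a third one with this color.\<close>
        have "\<not> same_color F y t x' s'" if "s \<oplus> t \<prec> s'" for x' s'
        proof
          assume "same_color F y t x' s'"
          from same_color_two[OF c this] ne have "s' = t \<or> s' = s" by auto
          moreover have "s \<preceq> s \<oplus> t" "t \<preceq> s \<oplus> t" by simp_all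
          ultimately show False using that ar.not_less by blast
        qed
        then show ?thesis by blast
      next
        case False
        \<comment> \<open>Only \<open>(y, t)\<close> itself can have this color, so \<open>t\<close>
          serves as the bound.\<close>
        then show ?thesis using less_irrefl by (intro exI[of _ t]) blast
      qed
      then show "\<exists>b. \<forall>s. ?Q s b p" by (cases "\<exists>y t. p = pr y t") (fastforce, blast)
    qed
    then obtain b where b: "\<And>p. p \<prec> pr (m \<oplus> one) m \<Longrightarrow> \<exists>b'. b' \<prec> b \<and> (\<forall>s. ?Q s b' p)" by blast
    \<comment> \<open>An element of \<open>A\<close> above \<open>m\<close> must have been rejected,
      through a pair of elements up to \<open>m\<close>; but such pairs cause no conflict beyond
      \<open>b\<close>.\<close>
    obtain s where s: "b \<oplus> m \<prec> s" "mem s A" using inf unfolding is_infinite_def by blast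
    have "b \<preceq> b \<oplus> m" "m \<preceq> b \<oplus> m" by simp_all
    then have bs: "b \<prec> s" "m \<prec> s" using s(1) ar.le_less_trans by blast+
    then have "\<not> mem s B" using m[of s] ar.not_less by blast
    then obtain y t x where c: "x \<prec> s" "mem y B" "mem t B" "same_color F y t x s"
      using s(2) unfolding B[of s] \<Phi>_def by blast
    have "y \<oplus> t \<preceq> m \<oplus> m" using m c(2,3) by (intro ar.add_mono) auto
    then have "y \<oplus> t \<prec> (m \<oplus> one) \<oplus> m" using less_Suc[of "y \<oplus> t" "m \<oplus> m"] by (simp add: algebra_simps)
    then have "pr y t \<prec> pr (m \<oplus> one) m" by (rule pr_less)
    from b[OF this] obtain b' where b': "b' \<prec> b" "\<And>s. ?Q s b' (pr y t)" by blast
    have "b' \<prec> s" using b'(1) bs(1) by (rule less_trans)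
    then show False using b'(2)[of s] c pr_bounds(1,2)[of y t] pr_bounds(2)[of t y] by blast
  qed
  ultimately show ?thesis by blast
qed

end

context BSigma02_model
begin

text \<open>A collision of \<open>(y, s)\<close> with \<open>(x, s)\<close> inside the free set,
  \<open>y \<prec> x\<close>, would give \<open>(x, s)\<close> the color \<open>y\<close> in the
  auxiliary coloring, a member of the set different from \<open>x\<close> and
  \<open>s\<close>.\<close>

theorem SFS2_imp_WSRRT22:
  assumes "sat e S SFS2"
  shows "sat e S WSRRT22"
  unfolding sat_WSRRT22
proof (intro allI impI)
  fix F assume F: "is_coloring F" "is_two_bounded F" "is_weakly_rainbow_stable F"
  obtain C where "\<And>x s y t. mem (pr (pr x s) (pr y t)) C \<longleftrightarrow> same_color F x s y t"
    using same_color_set[OF F(1)] by blast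
  then interpret rainbow_stable zero one add mul less mem F C
    using F by unfold_locales
  obtain G where G: "is_coloring G" "\<And>x s y. colored G x s y \<longleftrightarrow> partner x s y" using partner_coloring by blast
  have "is_stable G" unfolding is_stable_def G(2) using partner_stable by blast
  then obtain A where inf: "is_infinite A" and free: "is_free A G" using assms G(1) unfolding sat_SFS2 by blast
  show "\<exists>R. is_infinite R \<and> is_rainbow R F"
  proof (rule greedy_rainbow[OF inf])
    fix x y s assume *: "mem x A" "mem y A" "mem s A" "y \<prec> x" "x \<prec> s"
    show "\<not> same_color F y s x s"
    proof
      assume "same_color F y s x s"
      then have "colored G x s y" using * by (simp add: G(2) partner_def)
      then have "y = x \<or> y = s" using free * unfolding is_free_def by blast
      then show False using * less_irrefl less_trans by blast
    qed
  qed
qed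

end

section \<open>The theorem\<close>

theorem theorem6p14:
  shows "RCA0 \<union> BSigma02 \<turnstile> SFS2 \<^bold>\<longrightarrow> WSRRT22"
proof (rule ccontr)
  assume unprovable: "\<not> (RCA0 \<union> BSigma02 \<turnstile> SFS2 \<^bold>\<longrightarrow> WSRRT22)"
  define T where "T = insert (\<^bold>\<not> WSRRT22) (insert SFS2 (RCA0 \<union> BSigma02))"
  have "consistent T"
    unfolding consistent_def T_def using unprovable prv.RAA prv.ImpI by blast
  moreover have "\<forall>q\<in>T. bound 0 0 q"
  proof -
    have "bound 0 0 SFS2"
      by (simp add: SFS2_def coloring_def stable_def infinite_set_def free_set_def val_def pair_def
          Let_def And_def Or_def Neg_def ExN_def ExS_def)
    moreover have "bound 0 0 WSRRT22"
      by (simp add: WSRRT22_def coloring_def two_bounded_def weakly_rainbow_stable_def agree_def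
          infinite_set_def rainbow_def val_def pair_def shiftT_def Let_def And_def Or_def Neg_def
          ExN_def ExS_def)
    ultimately show ?thesis
      by (auto simp: T_def RCA0_def BSigma02_def Neg_def closures_closed)
  qed
  \<comment> \<open>Two number quantifiers close both successor axioms, one of them vacuously in the
    first axiom; this is the form that \<open>model_existence\<close> expects.\<close>
  moreover have "(AllN ^^ 2) p \<in> T" if "p \<in> basic_axioms" "bound 2 0 p" for p
  proof -
    have "(AllS ^^ 0) ((AllN ^^ 2) p) \<in> RCA0" unfolding RCA0_def closures_def using that by blast
    then show ?thesis by (simp add: T_def)
  qed
  then have "(AllN ^^ 2) (\<^bold>\<not> (Var 1 \<^bold>+ \<^bold>1 \<^bold>= \<^bold>0)) \<in> T"
    "(AllN ^^ 2) (Var 0 \<^bold>+ \<^bold>1 \<^bold>= Var 1 \<^bold>+ \<^bold>1 \<^bold>\<longrightarrow> Var 0 \<^bold>= Var 1) \<in> T"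
    by (simp_all add: basic_axioms_def Let_def Neg_def)
  ultimately obtain zero one :: nat and add mul less and mem :: "nat \<Rightarrow> nat \<Rightarrow> bool"
    where M: "\<And>e S q. q \<in> T \<Longrightarrow> L2_structure.sat zero one add mul less mem e S q"
    using model_existence[of T] by metis
  interpret L2_structure zero one add mul less mem .
  have RCA0: "sat e S p" if "p \<in> basic_axioms \<union> {ind p | p. p \<in> Sigma01}
     \<union> {comprehension p q | p q. p \<in> Sigma01 \<and> q \<in> Pi01}" for e S p
    by (rule sat_closures[OF M that]) (simp add: T_def RCA0_def)
  have BSigma02: "sat e S p" if "p \<in> {bounding p | p. p \<in> Sigma02}" for e S p
    by (rule sat_closures[OF M that]) (simp add: T_def BSigma02_def)
  interpret BSigma02_model zero one add mul less mem
    by unfold_locales (use RCA0 BSigma02 in blast)+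
  have "sat e S SFS2" "\<not> sat e S WSRRT22" for e S
    using M[of SFS2 e S] M[of "\<^bold>\<not> WSRRT22" e S] by (simp_all add: T_def)
  then show False using SFS2_imp_WSRRT22 by blast
qed

end
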